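(* Suppose a sequence $X$ of Persistent-Read operations, all executed on the same version, takes time $T(M,B)$ to execute ephemerally in the cache-oblivious model on a machine with memory $M$ and block size $B$ and an initially empty memory. Then in the persistent data structure described in the context, the runtime of $X$ is $$O\!\left( T\!\left(\frac{\frac 13 M}{B^{1-\frac{1-\epsilon}{\log 3}}(1+\log_BU)},\ B^{\frac{1-\epsilon}{\log 3}} \right)(1+\log_BU) \right).$$
   Context: Cache-oblivious model: a machine has internal memory of $M$ cells and external memory partitioned into blocks of $B$ consecutive cells; cost is the number of block transfers, with optimal block replacement; the algorithm does not know $M,B$. An ephemeral structure manipulates a memory array $A$ with primitives Read$(i)$ (return $A[i]$) and Write$(i,x)$ (set $A[i]=x$). Writes are numbered $1,2,\dots$; $V$ is the number of Writes so far and $A_v$ the state of $A$ after the $v$-th Write. Persistent-Read$(v,i)$ returns $A_v[i]$. The ephemeral cost $T(M,B)$ of a sequence of Persistent-Reads on version $v$ is that of the corresponding Reads on $A_v$ starting with empty internal memory, computed by partitioning the array into blocks of size $B$: an access costs $0$ if its cell lies in one of the $M/B$ blocks most recently touched by earlier accesses and $1$ otherwise. $\log$ is base $2$. The $v$-th Write, Write$(i,x)$, is represented by the point $(i,v)$ in the integer grid ($x$-axis address, $y$-axis time increasing upward); $P$ is the set of such points. ST-trees: each node has an axis-parallel grid rectangle, closed (four-sided) or open (unbounded upward). A node of height $h$ (leaves height $0$) has a rectangle of width $2^h$. Each internal node has a left and right child (half width, side by side) and possibly a third, upper child lying on top of one of them; children's rectangles partition the parent's. A leaf is full iff its rectangle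 contains a point of $P$; an internal node is full iff it has two full children; a node with three children has a full child; open rectangles are not full. Each node stores pointers to its children and parent and its rectangle's coordinates; each leaf also stores the at most one point of $P$ in its rectangle and the value $A_v[i]$ for the point $(i,v)$ at the bottom of its rectangle. Global structure: $U$ is the largest memory address written so far rounded up to a power of $2$. The structure keeps $\lceil V/U\rceil$ ST-trees whose root rectangles have width $U$: the $j$-th (bottom) tree has rectangle $[1..U]\times[(j-1)U+1..jU]$ and the last (top) tree has the open rectangle $[1..U]\times[(\lceil V/U\rceil-1)U+1..\infty)$. It also keeps a log of all Writes, an array $C$ of size $U$ ($C[i]$ holds the current $A[i]$ and a pointer to the leaf containing the highest point of $P$ in column $i$), and a pointer $p$ to the leaf reached by the most recent Persistent-Read. Storage: for a fixed constant $0<\epsilon<1$, the top tree is stored as a complete $3$-ary tree of height $\log U$ (space reserved for all potential nodes) in the biased van Emde Boas layout (a tree of height $h$ is split into a top tree of height $\epsilon h$ and $3^{\epsilon h}$ bottom trees of height $(1-\epsilon)h$, each laid out recursively in consecutive memory). A bottom tree is stored contiguously in the same node order but containing only the nodes actually present. Persistent-Read$(v,i)$: move $p$ to its parent until its rectangle contains $(i,v)$ or a root is reached; in the latter case set $p$ to the root of the tree whose rectangle contains $(i,v)$; then move $p$ down to the leaf whose rectangle contains $(i,v)$ and return the value stored there. Write$(i,x)$: if $i>U$, $U$ is doubled and everything is rebuilt by replaying the log; once every $U$ Writes the top tree is compressed into a new bottom tree and a new top tree is created as a complete binary tree (only left/right children) with open rectangles and leaves filled from $C$. Then $C[i]=x$,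 $V$ is incremented, the point $(i,V)$ is stored in the leaf containing it and that leaf is marked full. While the parent of the current full node already has three children, the parent is marked full and becomes current. For the final node $q$ (whose parent has two children), all open rectangles in $q$'s subtree are closed by setting their top side to $V$, and a third child is added to $q$'s parent: the root of a new complete binary tree of the same height as $q$ whose open rectangle lies directly on top of $q$'s rectangle and whose leaves are filled from $C$. In the analysis the internal memory is split into three equal parts, one dedicated to each of the primitives Read, Write and Persistent-Read.
   Formalization: The factor 1+log_B U in the memory argument of T is multiplied by a constant depending only on ε and the node size; with constant exactly 1 the bound fails (cyclic reads of K columns whose search paths need about 1.58·K·log_B U blocks). *)

theory Defs
  imports Complex_Main "HOL-Library.Extended_Real"
begin

section \<open>Ephemeral cost of a sequence of Reads\<close>

text \<open>Array addresses start at 1. The two parameters are real because the bound evaluates this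
  cost at non-integral arguments: the array is cut into blocks of width \<open>B\<close>, and \<open>M / B\<close> is
  rounded down when counting blocks.\<close>

definition array_block :: "real \<Rightarrow> nat \<Rightarrow> int" where
  "array_block B i = \<lfloor>(real i - 1) / B\<rfloor>"

text \<open>\<open>remdups\<close> keeps the last occurrence of every element, so the reversed list enumerates the
  distinct elements of a history by recency of their last use.\<close>

definition most_recent :: "nat \<Rightarrow> 'b list \<Rightarrow> 'b set" where
  "most_recent k hist = set (take k (rev (remdups hist)))"

definition ephemeral_cost :: "real \<Rightarrow> real \<Rightarrow> nat list \<Rightarrow> nat" where
  "ephemeral_cost M B is =
     card {t. t < length is \<and>
       array_block B (is ! t) \<notin> most_recent (nat \<lfloor>M / B\<rfloor>) (map (array_block B) (take t is))}"


section \<open>Block transfers with optimal replacement\<close>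

text \<open>\<open>S (Suc t)\<close> is the set of blocks in internal memory at the \<open>t\<close>-th access.\<close>

definition schedule :: "nat \<Rightarrow> nat list \<Rightarrow> (nat \<Rightarrow> nat set) \<Rightarrow> bool" where
  "schedule k bs S \<longleftrightarrow> S 0 = {} \<and>
     (\<forall>t<length bs. bs ! t \<in> S (Suc t) \<and> finite (S (Suc t)) \<and> card (S (Suc t)) \<le> k)"

definition transfers :: "nat list \<Rightarrow> (nat \<Rightarrow> nat set) \<Rightarrow> nat" where
  "transfers bs S = (\<Sum>t<length bs. card (S (Suc t) - S t))"

text \<open>The value is \<open>\<infinity>\<close> if there is an access but no room for a block.\<close>

definition optimal_cost :: "nat \<Rightarrow> nat list \<Rightarrow> enat" where
  "optimal_cost k bs = (INF S\<in>{S. schedule k bs S}. enat (transfers bs S))"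


section \<open>ST-trees\<close>

datatype rect = Rect (xlo: nat) (xhi: nat) (ylo: nat) (yhi: enat)

definition cells_of :: "rect \<Rightarrow> (nat \<times> nat) set" where
  "cells_of R = {(i, v). xlo R \<le> i \<and> i \<le> xhi R \<and> ylo R \<le> v \<and> enat v \<le> yhi R}"

definition close_rect :: "nat \<Rightarrow> rect \<Rightarrow> rect" where
  "close_rect V R = (if yhi R = \<infinity> then Rect (xlo R) (xhi R) (ylo R) (enat V) else R)"

text \<open>A leaf stores the point of \<open>P\<close> in its rectangle, if any, as the number of the Write together
  with the value written (its column is the column of the leaf), and the array value at the
  bottom of its rectangle. In \<open>Tri R l r u\<close> the node \<open>u\<close> is the upper child.\<close>

datatype 'a st =
    is_leaf: Leaf (rect_of: rect) "(nat \<times> 'a) option" 'a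
  | Bin (rect_of: rect) "'a st" "'a st"
  | Tri (rect_of: rect) "'a st" "'a st" "'a st"

fun st_height :: "'a st \<Rightarrow> nat" where
  "st_height (Leaf R pt a) = 0"
| "st_height (Bin R l r) = Suc (st_height l)"
| "st_height (Tri R l r u) = Suc (st_height l)"

fun close :: "nat \<Rightarrow> 'a st \<Rightarrow> 'a st" where
  "close V (Leaf R pt a) = Leaf (close_rect V R) pt a"
| "close V (Bin R l r) = Bin (close_rect V R) (close V l) (close V r)"
| "close V (Tri R l r u) = Tri (close_rect V R) (close V l) (close V r) (close V u)"

text \<open>\<open>complete_tree C h x y\<close> is the complete binary tree of height \<open>h\<close> with the open root rectangle
  \<open>[x .. x + 2 ^ h - 1] \<times> [y .. \<infinity>)\<close> and leaves filled from \<open>C\<close>.\<close>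

fun complete_tree :: "(nat \<Rightarrow> 'a) \<Rightarrow> nat \<Rightarrow> nat \<Rightarrow> nat \<Rightarrow> 'a st" where
  "complete_tree C 0 x y = Leaf (Rect x x y \<infinity>) None (C x)"
| "complete_tree C (Suc h) x y =
     Bin (Rect x (x + 2 ^ Suc h - 1) y \<infinity>) (complete_tree C h x y) (complete_tree C h (x + 2 ^ h) y)"

definition on_top :: "(nat \<Rightarrow> 'a) \<Rightarrow> nat \<Rightarrow> 'a st \<Rightarrow> 'a st" where
  "on_top C V q = complete_tree C (st_height q) (xlo (rect_of q)) (Suc V)"

text \<open>Store the point \<open>(i, V)\<close> of a Write of \<open>x\<close>. The flag tells whether the root of the resulting
  tree has just become full; a node with two children whose child has become full is the parent
  of the final node \<open>q\<close>, a node with three children whose child has become full becomes full.\<close>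

fun add_point :: "(nat \<Rightarrow> 'a) \<Rightarrow> nat \<Rightarrow> nat \<Rightarrow> 'a \<Rightarrow> 'a st \<Rightarrow> 'a st \<times> bool" where
  "add_point C V i x (Leaf R pt a) = (Leaf R (Some (V, x)) (if ylo R = V then x else a), True)"
| "add_point C V i x (Bin R l r) =
     (if (i, V) \<in> cells_of (rect_of l) then
        let (l', full) = add_point C V i x l
        in (if full then Tri R (close V l') r (on_top C V l') else Bin R l' r, False)
      else
        let (r', full) = add_point C V i x r
        in (if full then Tri R l (close V r') (on_top C V r') else Bin R l r', False))"
| "add_point C V i x (Tri R l r u) =
     (if (i, V) \<in> cells_of (rect_of l) then
        let (l', full) = add_point C V i x l in (Tri R l' r u, full)
      else if (i, V) \<in> cells_of (rect_of r) then
        let (r', full) = add_point C V i x r in (Tri R l r' u, full)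
      else
        let (u', full) = add_point C V i x u in (Tri R l r u', full))"


section \<open>The persistent structure\<close>

text \<open>\<open>lgU\<close> is \<open>log U\<close>; \<open>trees\<close> lists the ST-trees from bottom to top, so the last one is the top
  tree (there is none before the first Write).\<close>

record 'a pds =
  lgU :: nat
  wlog :: "(nat \<times> 'a) list"
  cur :: "nat \<Rightarrow> 'a"
  trees :: "'a st list"

definition U_of :: "'a pds \<Rightarrow> nat" where
  "U_of D = 2 ^ lgU D"

definition V_of :: "'a pds \<Rightarrow> nat" where
  "V_of D = length (wlog D)"

definition empty_pds :: "nat \<Rightarrow> 'a pds" where
  "empty_pds k = \<lparr>lgU = k, wlog = [], cur = (\<lambda>_. undefined), trees = []\<rparr>"

text \<open>A Write to an address at most \<open>U\<close>. When \<open>V\<close> is a multiple of \<open>U\<close>, the old top tree (if any)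
  becomes a bottom tree, which closes its open rectangles, and a new top tree is put above it.\<close>

definition write_small :: "nat \<times> 'a \<Rightarrow> 'a pds \<Rightarrow> 'a pds" where
  "write_small = (\<lambda>(i, x) D.
     let V = V_of D;
         ts = (if U_of D dvd V
               then map (close V) (trees D) @ [complete_tree (cur D) (lgU D) 1 (Suc V)]
               else trees D);
         C = (cur D)(i := x)
     in D\<lparr>wlog := wlog D @ [(i, x)],
          cur := C,
          trees := butlast ts @ [fst (add_point C (Suc V) i x (last ts))]\<rparr>)"

definition rebuild :: "nat \<Rightarrow> (nat \<times> 'a) list \<Rightarrow> 'a pds" where
  "rebuild k ws = fold write_small ws (empty_pds k)"

definition pds_write :: "nat \<times> 'a \<Rightarrow> 'a pds \<Rightarrow> 'a pds" where
  "pds_write w D = write_small w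
     (if fst w > U_of D then rebuild (LEAST k. fst w \<le> 2 ^ k) (wlog D) else D)"

text \<open>The state after a sequence of Writes; with no address written so far, \<open>U\<close> is 1.\<close>

definition after_writes :: "(nat \<times> 'a) list \<Rightarrow> 'a pds" where
  "after_writes ws = fold pds_write ws (empty_pds 0)"


section \<open>Nodes and Persistent-Reads\<close>

text \<open>A node is given by the position of its tree in \<open>trees\<close> and its path from the root
  (left, right, upper).\<close>

datatype dir = Left | Right | Upper

type_synonym ptr = "nat \<times> dir list"

fun subtree :: "'a st \<Rightarrow> dir list \<Rightarrow> 'a st" where
  "subtree t [] = t"
| "subtree (Bin _ l r) (Left # p) = subtree l p"
| "subtree (Bin _ l r) (Right # p) = subtree r p"
| "subtree (Tri _ l r u) (Left # p) = subtree l p"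
| "subtree (Tri _ l r u) (Right # p) = subtree r p"
| "subtree (Tri _ l r u) (Upper # p) = subtree u p"
| "subtree t _ = undefined"

fun nodes :: "'a st \<Rightarrow> dir list set" where
  "nodes (Leaf _ _ _) = {[]}"
| "nodes (Bin _ l r) = {[]} \<union> (#) Left ` nodes l \<union> (#) Right ` nodes r"
| "nodes (Tri _ l r u) = {[]} \<union> (#) Left ` nodes l \<union> (#) Right ` nodes r \<union> (#) Upper ` nodes u"

definition leaf_ptr :: "'a pds \<Rightarrow> ptr \<Rightarrow> bool" where
  "leaf_ptr D = (\<lambda>(j, p). j < length (trees D) \<and> p \<in> nodes (trees D ! j) \<and>
     is_leaf (subtree (trees D ! j) p))"

text \<open>The successive positions of the pointer on its way up, the initial one included.\<close>

fun climb :: "'a st \<Rightarrow> nat \<times> nat \<Rightarrow> dir list \<Rightarrow> dir list list" where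
  "climb t q p = (if p = [] \<or> q \<in> cells_of (rect_of (subtree t p)) then [p]
                  else p # climb t q (butlast p))"

text \<open>The nodes inspected on the way down to the leaf containing \<open>q\<close>. The rectangles of the
  children are inspected in the order left, right, upper until one contains \<open>q\<close>, so this list
  also charges for children that are inspected but not entered; its last element is the leaf.\<close>

fun descend :: "nat \<times> nat \<Rightarrow> 'a st \<Rightarrow> dir list list" where
  "descend q (Leaf _ _ _) = []"
| "descend q (Bin _ l r) =
     [Left] # (if q \<in> cells_of (rect_of l) then map ((#) Left) (descend q l)
               else [Right] # map ((#) Right) (descend q r))"
| "descend q (Tri _ l r u) =
     [Left] # (if q \<in> cells_of (rect_of l) then map ((#) Left) (descend q l)
               else [Right] # (if q \<in> cells_of (rect_of r) then map ((#) Right) (descend q r)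
                               else [Upper] # map ((#) Upper) (descend q u)))"

text \<open>Memory accesses of a Persistent-Read: a node of a tree, or the entry for a tree in the table
  of roots, consulted when the pointer is set to the root of another tree.\<close>

datatype access = Node ptr | Root_entry nat

fun leaf_value :: "nat \<Rightarrow> 'a st \<Rightarrow> 'a" where
  "leaf_value v (Leaf _ (Some (w, x)) a) = (if w \<le> v then x else a)"
| "leaf_value v (Leaf _ None a) = a"
| "leaf_value v _ = undefined"

text \<open>The result consists of the value read, the new pointer and the accesses in order.\<close>

definition persistent_read :: "'a pds \<Rightarrow> ptr \<Rightarrow> nat \<times> nat \<Rightarrow> 'a \<times> ptr \<times> access list" where
  "persistent_read D = (\<lambda>(j, p) (v, i).
     let ups = climb (trees D ! j) (i, v) p;
         found = (i, v) \<in> cells_of (rect_of (subtree (trees D ! j) (last ups)));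
         j' = (if found then j
               else LEAST k. k < length (trees D) \<and> (i, v) \<in> cells_of (rect_of (trees D ! k)));
         p' = (if found then last ups else []);
         downs = map ((@) p') (descend (i, v) (subtree (trees D ! j') p'));
         leaf = last (p' # downs)
     in (leaf_value v (subtree (trees D ! j') leaf),
         (j', leaf),
         map (\<lambda>p. Node (j, p)) ups
         @ (if found then [] else [Root_entry j', Node (j', [])])
         @ map (\<lambda>p. Node (j', p)) downs))"

fun read_accesses :: "'a pds \<Rightarrow> ptr \<Rightarrow> (nat \<times> nat) list \<Rightarrow> access list" where
  "read_accesses D p [] = []"
| "read_accesses D p (r # rs) =
     (case persistent_read D p r of (_, p', as) \<Rightarrow> as @ read_accesses D p' rs)"


section \<open>Storage\<close>

fun digit :: "dir \<Rightarrow> nat" where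
  "digit Left = 0" | "digit Right = 1" | "digit Upper = 2"

definition path_index :: "dir list \<Rightarrow> nat" where
  "path_index p = foldl (\<lambda>n d. 3 * n + digit d) 0 p"

definition ternary_size :: "nat \<Rightarrow> nat" where
  "ternary_size n = (\<Sum>k<n. 3 ^ k)"

text \<open>Position of the node with path \<open>p\<close> in the biased van Emde Boas layout of the complete 3-ary
  tree with \<open>n\<close> levels. The number of levels \<open>\<epsilon> n\<close> of the top part is rounded down, but is at
  least 1 and at most \<open>n - 1\<close>; the top part is followed by \<open>3 ^ t\<close> bottom parts with \<open>n - t\<close>
  levels, in left-to-right order.\<close>

definition top_levels :: "real \<Rightarrow> nat \<Rightarrow> nat" where
  "top_levels \<epsilon> n = max 1 (min (n - 1) (nat \<lfloor>\<epsilon> * real n\<rfloor>))"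

function veb_pos :: "real \<Rightarrow> nat \<Rightarrow> dir list \<Rightarrow> nat" where
  "veb_pos \<epsilon> n p =
     (if n \<le> 1 then 0
      else let t = top_levels \<epsilon> n
           in if length p < t then veb_pos \<epsilon> t p
              else ternary_size t + path_index (take t p) * ternary_size (n - t)
                   + veb_pos \<epsilon> (n - t) (drop t p))"
  by auto
termination
  by (relation "measure (\<lambda>(\<epsilon>, n, p). n)") (auto simp: top_levels_def)

declare climb.simps [simp del] veb_pos.simps [simp del]

text \<open>Rank of a node in the layout: in the top tree space is reserved for all potential nodes, in a
  bottom tree only the nodes present are stored, in the same order.\<close>

definition node_rank :: "real \<Rightarrow> 'a pds \<Rightarrow> ptr \<Rightarrow> nat" where
  "node_rank \<epsilon> D = (\<lambda>(j, p).
     let pos = veb_pos \<epsilon> (Suc (lgU D))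
     in if Suc j = length (trees D) then pos p
        else card {q \<in> nodes (trees D ! j). pos q < pos p})"

text \<open>The memory cells touched by an access. A node is a record of \<open>s\<close> cells; the \<open>j\<close>-th tree starts
  at address \<open>base j\<close> and the table of roots at address \<open>tab\<close>.\<close>

fun access_cells :: "real \<Rightarrow> nat \<Rightarrow> (nat \<Rightarrow> nat) \<Rightarrow> nat \<Rightarrow> 'a pds \<Rightarrow> access \<Rightarrow> nat list" where
  "access_cells \<epsilon> s base tab D (Node (j, p)) =
     (let a = base j + s * node_rank \<epsilon> D (j, p) in [a ..< a + s])"
| "access_cells \<epsilon> s base tab D (Root_entry j) = [tab + j]"

text \<open>Number of block transfers of a sequence of Persistent-Reads executed with the pointer initially
  at \<open>p\<close>, using the third of the internal memory dedicated to Persistent-Reads. The parameters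
  \<open>M\<close> and \<open>B\<close> enter only here, the structure does not depend on them.\<close>

definition persistent_runtime ::
  "real \<Rightarrow> nat \<Rightarrow> (nat \<Rightarrow> nat) \<Rightarrow> nat \<Rightarrow> nat \<Rightarrow> nat \<Rightarrow> 'a pds \<Rightarrow> ptr \<Rightarrow> (nat \<times> nat) list \<Rightarrow> enat" where
  "persistent_runtime \<epsilon> s base tab M B D p X =
     optimal_cost (M div (3 * B))
       (map (\<lambda>c. c div B)
         (concat (map (access_cells \<epsilon> s base tab D) (read_accesses D p X))))"

end

theory Submission
  imports Defs
begin

text \<open>The reads of one version follow root-to-leaf paths in a single ST-tree. Such a path splits into
  \<open>O(1 + log_B U)\<close> parts of the van Emde Boas layout that occupy at most \<open>B\<close> consecutive records, so
  it meets \<open>O(1 + log_B U)\<close> memory blocks; absent nodes and inspected siblings only cost a constant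
  factor. The part containing the leaves has at least \<open>(1 - \<epsilon>) log_3 B - 1\<close> levels, hence its root has
  width \<open>\<Omega>(B^\<gamma>)\<close> with \<open>\<gamma> = (1 - \<epsilon>) / log 3\<close>, so an array block of width \<open>B^\<gamma>\<close> meets at most five such
  parts, and the paths to all of its columns lie in a set \<open>W b\<close> of \<open>O(1 + log_B U)\<close> memory blocks.

  A memory that holds \<open>W b\<close> for every array block \<open>b\<close> in the ephemeral LRU memory pays nothing for
  an ephemeral hit, since the climb starts from a column of the most recent block, and
  \<open>O(1 + log_B U)\<close> for a miss. If the ephemeral memory holds no block, every ephemeral access
  is a miss, and the bound per read is needed with a single memory block: it holds because a
  descent visits addresses in ascending and a climb in descending order.\<close>

section \<open>Cost of access sequences\<close>

text \<open>Optimal replacement is never analysed: every explicit schedule bounds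
  \<open>optimal_cost\<close> from above, so it suffices to exhibit one. What shapes the constants
  is the room this schedule needs. While a missed array block is brought in, the sets of the at most
  \<open>k'\<close> array blocks held by the ephemeral memory and the new set are resident together,
  so \<open>k' + 1\<close> sets of \<open>w\<close> memory blocks have to fit into
  \<open>M div (3 * B)\<close>. For \<open>k' \<ge> 1\<close> this costs a factor 2, rounding
  \<open>M / (3 * B)\<close> down costs another factor 2, and \<open>w\<close> is 7 times
  \<open>part_const \<epsilon> s * (1 + log_B U)\<close>: 5 for the parts below one array block, 1
  for the path to the arbitrary leaf at which the pointer stands initially, 1 for the entry in the
  table of roots. Hence the constant \<open>28 = 2 * 2 * 7\<close> in the memory argument of the
  bound. The case \<open>k' = 0\<close> cannot be reduced to this one, as \<open>M = 3 * B\<close>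
  leaves room for one block only, far less than a single set.\<close>

inductive run :: "nat \<Rightarrow> nat set \<Rightarrow> nat list \<Rightarrow> nat set \<Rightarrow> nat \<Rightarrow> bool" for k where
  run_Nil: "run k S [] S 0"
| run_Cons: "x \<in> S' \<Longrightarrow> finite S' \<Longrightarrow> card S' \<le> k \<Longrightarrow> run k S' bs S'' n \<Longrightarrow>
    run k S (x # bs) S'' (card (S' - S) + n)"

text \<open>\<open>run\<close> is \<open>schedule\<close> in inductive form with an arbitrary
  initial memory, so that schedules can be concatenated. Shifting the memory sets by one index
  prepends \<open>S\<close>, and the transfer sum splits off its first term.\<close>

lemma run_schedule:
  assumes "run k S bs S' n"
  shows "\<exists>F. F 0 = S \<and>
    (\<forall>t<length bs. bs ! t \<in> F (Suc t) \<and> finite (F (Suc t)) \<and> card (F (Suc t)) \<le> k) \<and>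
    transfers bs F = n"
  using assms
proof (induction rule: run.induct)
  case (run_Nil S)
  show ?case by (rule exI[of _ "\<lambda>_. S"]) (simp add: transfers_def)
next
  case (run_Cons x S' bs S'' n S)
  then obtain F where F: "F 0 = S'"
    "\<forall>t<length bs. bs ! t \<in> F (Suc t) \<and> finite (F (Suc t)) \<and> card (F (Suc t)) \<le> k"
    "transfers bs F = n" by blast
  let ?G = "case_nat S F"
  have "(x # bs) ! t \<in> ?G (Suc t) \<and> finite (?G (Suc t)) \<and> card (?G (Suc t)) \<le> k"
    if "t < length (x # bs)" for t
    using that F run_Cons.hyps by (cases t) auto
  moreover have "transfers (x # bs) ?G = card (S' - S) + n"
    using F(1,3) by (simp add: transfers_def sum.lessThan_Suc_shift del: sum.lessThan_Suc)
  ultimately show ?case by (intro exI[of _ ?G]) auto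
qed

lemma optimal_cost_le:
  assumes "run k {} bs S n"
  shows "optimal_cost k bs \<le> enat n"
proof -
  obtain F where "schedule k bs F" "transfers bs F = n"
    using run_schedule[OF assms] by (auto simp: schedule_def)
  then show ?thesis
    unfolding optimal_cost_def by (metis INF_lower mem_Collect_eq)
qed

lemma run_append:
  assumes "run k S bs S' n" and "run k S' cs S'' n'"
  shows "run k S (bs @ cs) S'' (n + n')"
  using assms
proof (induction rule: run.induct)
  case (run_Cons x S' bs S''' n S)
  then show ?case using run.run_Cons[of x S' k "bs @ cs" S'' "n + n'" S] by (simp add: add.assoc)
qed simp

lemma run_hits:
  assumes "set bs \<subseteq> S" and "finite S" and "card S \<le> k"
  shows "run k S bs S 0"
  using assms(1)
proof (induction bs)
  case (Cons b bs)
  then show ?case using run.run_Cons[of b S k bs S 0 S] assms by simp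
qed (rule run_Nil)

text \<open>The first access fetches all of \<open>S'\<close>, also the blocks needed only later,
  and the rest are hits. Fetching several blocks at once is allowed, since \<open>transfers\<close>
  charges the size of set differences.\<close>

lemma run_load:
  assumes "bs \<noteq> []" and "set bs \<subseteq> S'" and "finite S'" and "card S' \<le> k"
  shows "run k S bs S' (card (S' - S))"
proof (cases bs)
  case (Cons b cs)
  then show ?thesis
    using run.run_Cons[OF _ assms(3,4) run_hits, of b cs S] assms by auto
qed (use assms in simp)

text \<open>The transfers made by a memory with room for one block that initially holds
  \<open>z\<close>.\<close>

fun changes :: "nat \<Rightarrow> nat list \<Rightarrow> nat" where
  "changes z [] = 0"
| "changes z (x # xs) = (if x = z then 0 else 1) + changes x xs"

lemma changes_append: "changes z (xs @ ys) = changes z xs + changes (last (z # xs)) ys"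
  by (induction xs arbitrary: z) auto

lemma changes_le_Suc: "changes z xs \<le> Suc (changes z' xs)"
  by (cases xs) auto

lemma changes_hd: "xs \<noteq> [] \<Longrightarrow> changes z xs = (if hd xs = z then 0 else 1) + changes (hd xs) xs"
  by (cases xs) auto

lemma run_changes:
  assumes "1 \<le> k"
  shows "run k {z} bs {last (z # bs)} (changes z bs)"
proof (induction bs arbitrary: z)
  case Nil
  then show ?case by (simp add: run_Nil)
next
  case (Cons b bs)
  have "run k {z} (b # bs) {last (b # bs)} (card ({b} - {z}) + changes b bs)"
    by (rule run_Cons) (use assms Cons in auto)
  then show ?case by (simp add: insert_Diff_if split: if_splits)
qed

text \<open>Only the first access distinguishes an empty memory from one holding \<open>z\<close>;
  it costs at most one more.\<close>

lemma run_changes_empty: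
  assumes "1 \<le> k"
  shows "\<exists>S n. run k {} bs S n \<and> n \<le> Suc (changes z bs)"
proof (cases bs)
  case Nil
  then show ?thesis using run_Nil[of k "{}"] by auto
next
  case (Cons b cs)
  have "run k {} (b # cs) {last (b # cs)} (card ({b} - {}) + changes b cs)"
    by (rule run_Cons) (use assms run_changes[OF assms] in auto)
  then show ?thesis unfolding Cons by fastforce
qed

text \<open>Equal blocks are adjacent in a sorted list, so no block is entered twice.\<close>

lemma changes_sorted: "sorted (z # xs) \<Longrightarrow> Suc (changes z xs) = card (insert z (set xs))"
proof (induction xs arbitrary: z)
  case (Cons x xs)
  then have IH: "Suc (changes x xs) = card (insert x (set xs))" by simp
  show ?case
  proof (cases "x = z")
    case True
    then show ?thesis using IH by simp
  next
    case False
    then have "z \<notin> insert x (set xs)" using Cons.prems by fastforce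
    then show ?thesis using IH False by simp
  qed
qed simp

lemma changes_sorted_le:
  assumes "sorted xs"
  shows "changes z xs \<le> card (set xs)"
proof (cases xs)
  case (Cons x ys)
  then have "Suc (changes x ys) = card (set xs)" using assms changes_sorted[of x ys] by simp
  moreover have "changes z xs \<le> Suc (changes x ys)" using Cons by simp
  ultimately show ?thesis by simp
qed simp

section \<open>Block changes caused by records read in address order\<close>

definition cell_blocks :: "nat \<Rightarrow> nat \<Rightarrow> nat \<Rightarrow> nat list" where
  "cell_blocks B s a = map (\<lambda>c. c div B) [a..<a + s]"

lemma sorted_cell_blocks: "sorted (cell_blocks B s a)"
  unfolding cell_blocks_def sorted_map
  by (rule sorted_wrt_mono_rel[OF _ sorted_upt]) (simp add: div_le_mono)

lemma set_cell_blocks: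
  assumes "0 < B" and "0 < s"
  shows "set (cell_blocks B s a) = {a div B..(a + s - 1) div B}"
proof
  show "set (cell_blocks B s a) \<subseteq> {a div B..(a + s - 1) div B}"
    by (auto simp: cell_blocks_def intro!: div_le_mono)
  show "{a div B..(a + s - 1) div B} \<subseteq> set (cell_blocks B s a)"
  proof
    fix b assume b: "b \<in> {a div B..(a + s - 1) div B}"
    \<comment> \<open>The first cell of the record that lies in block \<open>b\<close>.\<close>
    let ?c = "max a (b * B)"
    have "b * B \<le> a + s - 1" 
      using b assms by (simp add: less_eq_div_iff_mult_less_eq)
    then have "?c \<in> {a..<a + s}" using assms by auto
    moreover have "?c div B = b"
    proof (cases "a \<le> b * B")
      case False
      then have "b \<le> a div B" using assms by (simp add: less_eq_div_iff_mult_less_eq)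
      then show ?thesis using b False by auto
    qed (use assms in auto)
    ultimately show "b \<in> set (cell_blocks B s a)" unfolding cell_blocks_def by (metis image_eqI set_map set_upt)
  qed
qed

lemma
  assumes "0 < s"
  shows hd_cell_blocks: "hd (cell_blocks B s a) = a div B"
    and last_cell_blocks: "last (cell_blocks B s a) = (a + s - 1) div B"
    and cell_blocks_not_Nil: "cell_blocks B s a \<noteq> []"
  using assms by (auto simp: cell_blocks_def last_map hd_map)

lemma changes_ascending:
  assumes "sorted_wrt (\<lambda>a b. a + s \<le> b) as"
  shows "changes z (concat (map (cell_blocks B s) as)) \<le> card (\<Union>a\<in>set as. set (cell_blocks B s a))"
proof -
  have "sorted (concat (map (cell_blocks B s) as))"
    using assms
  proof (induction as)
    case (Cons a as)
    have "c \<le> d" if "c \<in> set (cell_blocks B s a)" "b \<in> set as" "d \<in> set (cell_blocks B s b)" for b c d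
    proof -
      have "a + s \<le> b" using Cons.prems that(2) by simp
      then show ?thesis using that(1,3) by (auto simp: cell_blocks_def intro!: div_le_mono)
    qed
    then show ?case using Cons sorted_cell_blocks by (auto simp: sorted_append)
  qed simp
  from changes_sorted_le[OF this] show ?thesis by simp
qed

text \<open>A record of \<open>s\<close> cells is read upwards even when the records come in descending order, so the
  blocks of a record that straddles a block boundary may be entered twice. The \<open>if\<close> summand is
  the reserve for this.\<close>

lemma changes_descending_hd:
  assumes "0 < B" and "0 < s" and "sorted_wrt (\<lambda>a b. b + s \<le> a) (a # as)"
  shows "changes (a div B) (concat (map (cell_blocks B s) (a # as)))
    + (if a div B < (a + s - 1) div B then 2 else 1)
    \<le> 3 * card (\<Union>a\<in>set (a # as). set (cell_blocks B s a))"
  using assms(3)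
proof (induction as arbitrary: a)
  have own: "changes (a div B) (cell_blocks B s a) = (a + s - 1) div B - a div B" for a
  proof -
    let ?xs = "cell_blocks B s a"
    have "?xs = a div B # tl ?xs"
      using hd_cell_blocks cell_blocks_not_Nil assms(2) by (metis list.collapse)
    then have "changes (a div B) ?xs = changes (a div B) (tl ?xs)"
      and "sorted (a div B # tl ?xs)" and "set ?xs = insert (a div B) (set (tl ?xs))"
      using sorted_cell_blocks[of B s a] changes.simps(2)[of "a div B" "a div B"]
      by (simp_all only: list.set(2)[symmetric]) (metis add_0)
    then have "Suc (changes (a div B) ?xs) = card (set ?xs)"
      using changes_sorted by metis
    moreover have "a div B \<le> (a + s - 1) div B" using assms by (intro div_le_mono) simp
    ultimately show ?thesis using set_cell_blocks[OF assms(1,2)] by simp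
  qed
  {
    case Nil
    have "a div B \<le> (a + s - 1) div B" using assms by (intro div_le_mono) simp
    then show ?case using own[of a] set_cell_blocks[OF assms(1,2)] by (auto simp: Suc_diff_le)
  next
    case (Cons b as)
    let ?bl = "cell_blocks B s"
    define x y x1 y1 where "x = a div B" and "y = (a + s - 1) div B"
      and "x1 = b div B" and "y1 = (b + s - 1) div B"
    define S where "S = (\<Union>a\<in>set (b # as). set (?bl a))"
    define g where "g = changes x1 (concat (map ?bl (b # as)))"
    have IH: "g + (if x1 < y1 then 2 else 1) \<le> 3 * card S"
      unfolding g_def S_def x1_def y1_def using Cons by simp
    have ba: "b + s \<le> a" using Cons.prems by simp
    have le: "x \<le> y" "x1 \<le> y1" "y1 \<le> x"
      unfolding x_def y_def x1_def y1_def using assms ba by (auto intro!: div_le_mono)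
    have fin: "finite S" by (simp add: S_def)
    have Sle: "S \<subseteq> {..y1}"
    proof -
      have "a' + s \<le> b + s" if "a' \<in> set (b # as)" for a'
        using that Cons.prems by auto
      then have "(a' + s - 1) div B \<le> y1" if "a' \<in> set (b # as)" for a'
        unfolding y1_def using that by (intro div_le_mono diff_le_mono)
      then show ?thesis unfolding S_def set_cell_blocks[OF assms(1,2)] by (fastforce dest: order_trans)
    qed
    have y1S: "y1 \<in> S" unfolding S_def set_cell_blocks[OF assms(1,2)] using le
      by (auto simp: x1_def y1_def)
    have all: "(\<Union>a\<in>set (a # b # as). set (?bl a)) = {x..y} \<union> S"
      unfolding S_def x_def y_def using set_cell_blocks[OF assms(1,2)] by simp
    have hd: "hd (concat (map ?bl (b # as))) = x1" "concat (map ?bl (b # as)) \<noteq> []"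
      unfolding x1_def using hd_cell_blocks[OF assms(2)] cell_blocks_not_Nil[OF assms(2)] by auto
    have "changes x (concat (map ?bl (a # b # as)))
      = changes x (?bl a) + changes (last (x # ?bl a)) (concat (map ?bl (b # as)))"
      by (simp add: changes_append del: last.simps)
    also have "last (x # ?bl a) = y"
      using last_cell_blocks[OF assms(2)] cell_blocks_not_Nil[OF assms(2)] by (simp add: y_def)
    also have "changes x (?bl a) = y - x" using own by (simp add: x_def y_def)
    also have "changes y (concat (map ?bl (b # as))) = (if x1 = y then 0 else 1) + g"
      using changes_hd[OF hd(2), of y] hd(1) by (simp add: g_def)
    finally have ch: "changes x (concat (map ?bl (a # b # as))) = y - x + ((if x1 = y then 0 else 1) + g)" .
    \<comment> \<open>Outside the case \<open>x = y = y1\<close> the record brings at least one new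
      block, whose weight 3 pays for entering it and for the reserve. In that case there is none,
      and the move down to \<open>x1\<close> is paid from the reserve of the record below.\<close>
    have "changes x (concat (map ?bl (a # b # as))) + (if x < y then 2 else 1) \<le> 3 * card ({x..y} \<union> S)"
    proof (cases "x < y")
      case True
      have "card S + (y - x) = card ({x<..y} \<union> S)"
        using fin Sle le by (subst card_Un_disjoint) auto
      also have "\<dots> \<le> card ({x..y} \<union> S)" using fin by (intro card_mono) auto
      finally have "card S + (y - x) \<le> card ({x..y} \<union> S)" .
      then show ?thesis using ch IH True by (auto split: if_splits)
    next
      case False
      then have xy: "x = y" using le by simp
      show ?thesis
      proof (cases "x = y1")
        case True
        then have "{x..y} \<union> S = S" using xy y1S by auto
        then show ?thesis using ch IH True xy le by (auto split: if_splits)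
      next
        case False
        then have "x \<notin> S" using Sle le by auto
        then have "card ({x..y} \<union> S) = Suc (card S)" using xy fin by simp
        then show ?thesis using ch IH xy by (auto split: if_splits)
      qed
    qed
    then show ?case unfolding all x_def y_def .
  }
qed

text \<open>Starting with \<open>z\<close> instead of the first block costs at most one more, which
  the reserve in \<open>changes_descending_hd\<close> absorbs.\<close>

lemma changes_descending:
  assumes "0 < B" and "0 < s" and "sorted_wrt (\<lambda>a b. b + s \<le> a) as"
  shows "changes z (concat (map (cell_blocks B s) as)) \<le> 3 * card (\<Union>a\<in>set as. set (cell_blocks B s a))"
proof (cases as)
  case (Cons a as')
  then show ?thesis
    using changes_descending_hd[OF assms(1,2), of a as'] assms(3)
      changes_le_Suc[of z "concat (map (cell_blocks B s) as)" "a div B"]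
    by (auto split: if_splits)
qed simp

section \<open>LRU memory and its misses\<close>

lemma most_recent_Nil: "most_recent k [] = {}"
  by (simp add: most_recent_def)

lemma rev_remdups_snoc: "rev (remdups (xs @ [x])) = x # filter (\<lambda>y. y \<noteq> x) (rev (remdups xs))"
proof -
  have "remdups (xs @ [x]) = filter (\<lambda>y. y \<noteq> x) (remdups xs) @ [x]"
    by (induction xs) auto
  then show ?thesis by (simp add: rev_filter)
qed

text \<open>Using \<open>b\<close> moves it to the front of the recency order. Deleting one element
  from the rest moves later ones up by at most one place, so the first \<open>j\<close> of them were
  among the first \<open>Suc j\<close> before.\<close>

lemma most_recent_snoc_subset: "most_recent k (h @ [b]) \<subseteq> insert b (most_recent k h)"
proof -
  have *: "set (take k (filter (\<lambda>y. y \<noteq> b) xs)) \<subseteq> set (take (Suc k) xs)"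
    if "distinct xs" for k and xs :: "'a list"
    using that
  proof (induction xs arbitrary: k)
    case (Cons x xs)
    show ?case
    proof (cases "x = b")
      case True
      then have "filter (\<lambda>y. y \<noteq> b) xs = xs" using Cons.prems by (auto simp: filter_id_conv)
      then show ?thesis using True by auto
    next
      case False
      then show ?thesis using Cons by (cases k) auto
    qed
  qed simp
  show ?thesis
  proof (cases k)
    case (Suc j)
    have "set (take j (filter (\<lambda>y. y \<noteq> b) (rev (remdups h)))) \<subseteq> set (take (Suc j) (rev (remdups h)))"
      by (rule *) simp
    then show ?thesis
      unfolding most_recent_def rev_remdups_snoc Suc take_Suc_Cons by auto
  qed (simp add: most_recent_def)
qed

lemma most_recent_snoc_self: "1 \<le> k \<Longrightarrow> b \<in> most_recent k (h @ [b])"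
  by (cases k) (auto simp: most_recent_def rev_remdups_snoc)

lemma card_most_recent_le: "card (most_recent k h) \<le> k"
  unfolding most_recent_def by (metis card_length length_take min.cobounded2 order_trans)

lemma finite_most_recent [simp]: "finite (most_recent k h)"
  by (simp add: most_recent_def)

text \<open>The history \<open>h\<close> is a separate argument so that the count can be unfolded
  one access at a time.\<close>

definition misses :: "nat \<Rightarrow> 'b list \<Rightarrow> 'b list \<Rightarrow> nat" where
  "misses k h bs = card {t. t < length bs \<and> bs ! t \<notin> most_recent k (h @ take t bs)}"

lemma misses_Nil: "misses k h [] = 0"
  by (simp add: misses_def)

lemma misses_Cons:
  "misses k h (b # bs) = (if b \<in> most_recent k h then 0 else 1) + misses k (h @ [b]) bs"
proof -
  let ?A = "{t. t < length bs \<and> bs ! t \<notin> most_recent k ((h @ [b]) @ take t bs)}"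
  have "{t. t < length (b # bs) \<and> (b # bs) ! t \<notin> most_recent k (h @ take t (b # bs))}
    = (if b \<in> most_recent k h then {} else {0}) \<union> Suc ` ?A"
    by (auto simp: less_Suc_eq_0_disj image_iff split: nat.splits)
  moreover have "card (Suc ` ?A) = card ?A" by (simp add: card_image)
  ultimately show ?thesis unfolding misses_def
    by (simp add: card_insert_if image_iff)
qed

lemma ephemeral_cost_misses:
  "ephemeral_cost M B is = misses (nat \<lfloor>M / B\<rfloor>) [] (map (array_block B) is)"
  unfolding ephemeral_cost_def misses_def by (rule arg_cong[where f = card]) (auto simp: take_map)

lemma misses_zero: "misses 0 h bs = length bs"
  by (induction bs arbitrary: h) (auto simp: misses_Nil misses_Cons most_recent_def)


section \<open>The biased van Emde Boas layout\<close>

lemma ternary_size_closed: "2 * ternary_size n + 1 = 3 ^ n"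
  by (induction n) (auto simp: ternary_size_def)

lemma ternary_size_mono: "m \<le> n \<Longrightarrow> ternary_size m \<le> ternary_size n"
  unfolding ternary_size_def by (intro sum_mono2) auto

lemma ternary_size_add: "ternary_size t + 3 ^ t * ternary_size k = ternary_size (t + k)"
proof -
  have "2 * (ternary_size t + 3 ^ t * ternary_size k) + 1 = (2 * ternary_size t + 1) + 3 ^ t * (2 * ternary_size k)"
    by simp
  also have "\<dots> = 3 ^ t * (2 * ternary_size k + 1)"
    using ternary_size_closed[of t] by (simp add: distrib_left)
  also have "\<dots> = 3 ^ (t + k)" by (simp only: ternary_size_closed power_add)
  also have "\<dots> = 2 * ternary_size (t + k) + 1" by (simp only: ternary_size_closed)
  finally show ?thesis by simp
qed

lemma top_levels_bounds:
  assumes "2 \<le> n"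
  shows "1 \<le> top_levels \<epsilon> n" and "top_levels \<epsilon> n < n"
  using assms by (auto simp: top_levels_def)

lemma digit_less: "digit d < 3"
  by (cases d) auto

lemma digit_inject: "digit d = digit d' \<Longrightarrow> d = d'"
  by (cases d; cases d') auto

lemma path_index_snoc: "path_index (p @ [d]) = 3 * path_index p + digit d"
  by (simp add: path_index_def)

lemma path_index_less: "path_index p < 3 ^ length p"
proof (induction p rule: rev_induct)
  case (snoc d p)
  then show ?case using digit_less[of d] by (simp add: path_index_snoc)
qed (simp add: path_index_def)

lemma path_index_inject:
  "length p = length q \<Longrightarrow> path_index p = path_index q \<Longrightarrow> p = q"
proof (induction p arbitrary: q rule: rev_induct)
  case (snoc d p)
  then obtain q' d' where q: "q = q' @ [d']" by (cases q rule: rev_exhaust) auto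
  have "3 * path_index p + digit d = 3 * path_index q' + digit d'"
    using snoc.prems by (simp add: q path_index_snoc)
  then have "path_index p = path_index q'" "digit d = digit d'"
    using digit_less[of d] digit_less[of d'] by presburger+
  then show ?case using snoc digit_inject by (simp add: q)
qed simp

lemma veb_pos_top:
  "2 \<le> n \<Longrightarrow> length p < top_levels \<epsilon> n \<Longrightarrow> veb_pos \<epsilon> n p = veb_pos \<epsilon> (top_levels \<epsilon> n) p"
  by (subst veb_pos.simps) (simp add: Let_def)

lemma veb_pos_bottom:
  "2 \<le> n \<Longrightarrow> t = top_levels \<epsilon> n \<Longrightarrow> t \<le> length p \<Longrightarrow>
   veb_pos \<epsilon> n p = ternary_size t + path_index (take t p) * ternary_size (n - t)
     + veb_pos \<epsilon> (n - t) (drop t p)"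
  by (subst veb_pos.simps) (simp add: Let_def)

lemma veb_pos_less: "length p < n \<Longrightarrow> veb_pos \<epsilon> n p < ternary_size n"
proof (induction n arbitrary: p rule: less_induct)
  case (less n)
  show ?case
  proof (cases "2 \<le> n")
    case False
    then have "n = 1" using less.prems by simp
    then show ?thesis by (subst veb_pos.simps) (simp add: ternary_size_def)
  next
    case n: True
    define t where "t = top_levels \<epsilon> n"
    have t: "1 \<le> t" "t < n" using top_levels_bounds[OF n] by (auto simp: t_def)
    show ?thesis
    proof (cases "length p < t")
      case True
      then show ?thesis
        using less.IH[of t p] veb_pos_top[OF n] t ternary_size_mono[of t n] by (simp add: t_def)
    next
      case False
      have "veb_pos \<epsilon> (n - t) (drop t p) < ternary_size (n - t)"
        using less.prems t False by (intro less.IH) auto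
      moreover have "(path_index (take t p) + 1) * ternary_size (n - t) \<le> 3 ^ t * ternary_size (n - t)"
        using path_index_less[of "take t p"] False by (intro mult_right_mono) (simp_all add: min_absorb2)
      ultimately show ?thesis
        using veb_pos_bottom[OF n t_def, of p] False ternary_size_add[of t "n - t"] t by simp
    qed
  qed
qed

lemma div_block:
  fixes a b c d k :: nat
  assumes "a * k + b = c * k + d" and "b < k" and "d < k"
  shows "a = c \<and> b = d"
  using assms by (metis add.commute div_mult_self1 div_less add_0 mod_mult_self1 mod_less not_less_zero)

text \<open>Below the top part, a position is a part number times the part size plus an offset
  smaller than that size, and division recovers both. Injectivity later limits how many nodes a
  window of positions can contain.\<close>

lemma veb_pos_inject:
  "length p < n \<Longrightarrow> length q < n \<Longrightarrow> veb_pos \<epsilon> n p = veb_pos \<epsilon> n q \<Longrightarrow> p = q"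
proof (induction n arbitrary: p q rule: less_induct)
  case (less n)
  show ?case
  proof (cases "2 \<le> n")
    case False
    then have "length p = 0" "length q = 0" using less.prems by linarith+
    then show ?thesis by simp
  next
    case n: True
    define t where "t = top_levels \<epsilon> n"
    have t: "1 \<le> t" "t < n" using top_levels_bounds[OF n] by (auto simp: t_def)
    have top: "veb_pos \<epsilon> n r = veb_pos \<epsilon> t r \<and> veb_pos \<epsilon> t r < ternary_size t"
      if "length r < t" for r
      using that veb_pos_top[OF n] veb_pos_less by (simp add: t_def)
    have bot: "veb_pos \<epsilon> n r = ternary_size t + path_index (take t r) * ternary_size (n - t)
      + veb_pos \<epsilon> (n - t) (drop t r)"
      if "t \<le> length r" for r
      using that veb_pos_bottom[OF n t_def] by simp
    consider "length p < t" "length q < t" | "length p < t" "t \<le> length q"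
      | "t \<le> length p" "length q < t" | "t \<le> length p" "t \<le> length q" by linarith
    then show ?thesis
    proof cases
      case 1
      then show ?thesis using less.IH[of t p q] top t less.prems by simp
    next
      case 2
      have "veb_pos \<epsilon> n p < ternary_size t" "ternary_size t \<le> veb_pos \<epsilon> n q"
        using top[OF 2(1)] bot[OF 2(2)] by linarith+
      then show ?thesis using less.prems by simp
    next
      case 3
      have "veb_pos \<epsilon> n q < ternary_size t" "ternary_size t \<le> veb_pos \<epsilon> n p"
        using top[OF 3(2)] bot[OF 3(1)] by linarith+
      then show ?thesis using less.prems by simp
    next
      case 4
      have "path_index (take t p) * ternary_size (n - t) + veb_pos \<epsilon> (n - t) (drop t p)
        = path_index (take t q) * ternary_size (n - t) + veb_pos \<epsilon> (n - t) (drop t q)"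
        using bot[OF 4(1)] bot[OF 4(2)] less.prems by simp
      moreover have "veb_pos \<epsilon> (n - t) (drop t p) < ternary_size (n - t)"
        "veb_pos \<epsilon> (n - t) (drop t q) < ternary_size (n - t)"
        using 4 less.prems t by (auto intro!: veb_pos_less)
      ultimately have "path_index (take t p) = path_index (take t q) \<and>
          veb_pos \<epsilon> (n - t) (drop t p) = veb_pos \<epsilon> (n - t) (drop t q)"
        by (rule div_block)
      then have eq: "path_index (take t p) = path_index (take t q)"
        "veb_pos \<epsilon> (n - t) (drop t p) = veb_pos \<epsilon> (n - t) (drop t q)"
        by simp_all
      have "take t p = take t q" using 4 eq(1) by (intro path_index_inject) auto
      moreover have "drop t p = drop t q"
        using eq(2) 4 less.prems t by (intro less.IH[of "n - t"]) auto
      ultimately show ?thesis by (metis append_take_drop_id)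
    qed
  qed
qed

text \<open>If the split separates the two nodes, the child is the root of a bottom part, and all
  bottom parts come after the top part; otherwise both lie in the same smaller part.\<close>

lemma veb_pos_child: "Suc (length p) < n \<Longrightarrow> veb_pos \<epsilon> n p < veb_pos \<epsilon> n (p @ [d])"
proof (induction n arbitrary: p rule: less_induct)
  case (less n)
  then have n: "2 \<le> n" by simp
  define t where "t = top_levels \<epsilon> n"
  have t: "1 \<le> t" "t < n" using top_levels_bounds[OF n] by (auto simp: t_def)
  consider "Suc (length p) < t" | "Suc (length p) = t" | "t \<le> length p" by linarith
  then show ?case
  proof cases
    case 1
    then show ?thesis using less.IH[of t p] veb_pos_top[OF n] t by (simp add: t_def)
  next
    case 2
    then show ?thesis
      using veb_pos_top[OF n, of p \<epsilon>] veb_pos_less[of p t \<epsilon>] veb_pos_bottom[OF n t_def, of "p @ [d]"]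
      by (simp add: t_def)
  next
    case 3
    then show ?thesis
      using less.IH[of "n - t" "drop t p"] t less.prems veb_pos_bottom[OF n t_def, of "p @ [d]"]
        veb_pos_bottom[OF n t_def, of p] by simp
  qed
qed

lemma veb_pos_extend:
  assumes "length (p @ r) < n" and "r \<noteq> []"
  shows "veb_pos \<epsilon> n p < veb_pos \<epsilon> n (p @ r)"
  using assms
proof (induction r rule: rev_induct)
  case (snoc d r)
  then show ?case
    using veb_pos_child[of "p @ r" n \<epsilon> d] by (cases "r = []") auto
qed simp

text \<open>Siblings lie in the same smaller part or are the roots of different bottom parts, which
  are laid out by \<open>path_index\<close>.\<close>

lemma veb_pos_sibling:
  "Suc (length p) < n \<Longrightarrow> digit d < digit d' \<Longrightarrow> veb_pos \<epsilon> n (p @ [d]) < veb_pos \<epsilon> n (p @ [d'])"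
proof (induction n arbitrary: p rule: less_induct)
  case (less n)
  then have n: "2 \<le> n" by simp
  define t where "t = top_levels \<epsilon> n"
  have t: "1 \<le> t" "t < n" using top_levels_bounds[OF n] by (auto simp: t_def)
  consider "Suc (length p) < t" | "Suc (length p) = t" | "t \<le> length p" by linarith
  then show ?case
  proof cases
    case 1
    then show ?thesis using less veb_pos_top[OF n] t by (simp add: t_def)
  next
    case 2
    have le: "path_index (p @ [d]) * ternary_size (n - t) + ternary_size (n - t) \<le> path_index (p @ [d']) * ternary_size (n - t)"
      using less.prems mult_right_mono[of "path_index (p @ [d]) + 1" "path_index (p @ [d'])" "ternary_size (n - t)"]
      by (simp add: path_index_snoc distrib_right)
    have lt: "veb_pos \<epsilon> (n - t) [] < ternary_size (n - t)" using t by (intro veb_pos_less) simp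
    have pos: "veb_pos \<epsilon> n (p @ [e]) = ternary_size t + path_index (p @ [e]) * ternary_size (n - t)
      + veb_pos \<epsilon> (n - t) []" for e
      using 2 veb_pos_bottom[OF n t_def, of "p @ [e]"] by simp
    show ?thesis using le lt pos[of d] pos[of d'] by linarith
  next
    case 3
    then show ?thesis
      using less.IH[of "n - t" "drop t p"] t less.prems veb_pos_bottom[OF n t_def, of "p @ [d]"]
        veb_pos_bottom[OF n t_def, of "p @ [d']"] by simp
  qed
qed

text \<open>A share of the levels that both sides of every split receive despite rounding:
  \<open>\<epsilon> / 2\<close> because rounding down a number that is at least 1 at most halves it,
  \<open>1 - \<epsilon>\<close> for the bottom parts, and \<open>1 / 2\<close> because a part
  clamped to \<open>n - 1\<close> levels still has at least \<open>n / 2\<close> of them.\<close>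

definition split_ratio :: "real \<Rightarrow> real" where
  "split_ratio \<epsilon> = min (\<epsilon> / 2) (min (1 - \<epsilon>) (1 / 2))"

lemma split_ratio_bounds:
  assumes "0 < \<epsilon>" and "\<epsilon> < 1"
  shows "0 < split_ratio \<epsilon>" and "split_ratio \<epsilon> \<le> 1 / 2"
  using assms by (auto simp: split_ratio_def min_def)

text \<open>Rounding down favours the bottom parts. Only the clamp to at least one top level can
  take away more than \<open>\<epsilon> * n\<close> levels, and then exactly one level is
  lost.\<close>

lemma bottom_levels_ge:
  assumes "0 < \<epsilon>" and "\<epsilon> < 1" and "2 \<le> n"
  shows "(1 - \<epsilon>) * real n \<le> real (n - top_levels \<epsilon> n) \<or> top_levels \<epsilon> n = 1"
proof (cases "top_levels \<epsilon> n = 1")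
  case False
  then have "top_levels \<epsilon> n \<le> nat \<lfloor>\<epsilon> * real n\<rfloor>" by (auto simp: top_levels_def)
  then have "real (top_levels \<epsilon> n) \<le> real_of_int \<lfloor>\<epsilon> * real n\<rfloor>"
    using assms by (metis of_nat_le_iff of_nat_nat zero_le_floor mult_nonneg_nonneg less_imp_le of_nat_0_le_iff)
  then have "real (top_levels \<epsilon> n) \<le> \<epsilon> * real n" by linarith
  moreover have "real (n - top_levels \<epsilon> n) = real n - real (top_levels \<epsilon> n)"
    using top_levels_bounds(2)[OF assms(3)] by (simp add: of_nat_diff less_imp_le)
  ultimately show ?thesis by (simp add: left_diff_distrib)
qed simp

lemma part_levels_ge:
  assumes "0 < \<epsilon>" and "\<epsilon> < 1" and "2 \<le> n"
  shows "split_ratio \<epsilon> * real n \<le> real (top_levels \<epsilon> n)"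
    and "split_ratio \<epsilon> * real n \<le> real (n - top_levels \<epsilon> n)"
proof -
  have half: "split_ratio \<epsilon> * real n \<le> real (n - 1)"
  proof -
    have "split_ratio \<epsilon> * real n \<le> (1 / 2) * real n"
      using split_ratio_bounds[OF assms(1,2)] by (intro mult_right_mono) auto
    also have "\<dots> \<le> real (n - 1)" using assms(3) by (simp add: of_nat_diff)
    finally show ?thesis .
  qed
  have mono: "split_ratio \<epsilon> * real n \<le> c * real n" if "split_ratio \<epsilon> \<le> c" for c
    using that by (intro mult_right_mono) auto
  have "split_ratio \<epsilon> * real n \<le> real (nat \<lfloor>\<epsilon> * real n\<rfloor>) \<or> split_ratio \<epsilon> * real n \<le> 1"
  proof (cases "\<epsilon> * real n < 1")
    case True
    moreover have "split_ratio \<epsilon> \<le> \<epsilon>" using assms by (auto simp: split_ratio_def)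
    ultimately show ?thesis using mono[of \<epsilon>] by linarith
  next
    case False
    then have "1 \<le> \<lfloor>\<epsilon> * real n\<rfloor>" by linarith
    then have "\<epsilon> / 2 * real n \<le> real_of_int \<lfloor>\<epsilon> * real n\<rfloor>" by linarith
    moreover have "real_of_int \<lfloor>\<epsilon> * real n\<rfloor> = real (nat \<lfloor>\<epsilon> * real n\<rfloor>)"
      using \<open>1 \<le> \<lfloor>\<epsilon> * real n\<rfloor>\<close> by simp
    moreover have "split_ratio \<epsilon> \<le> \<epsilon> / 2"
      unfolding split_ratio_def by (rule min.cobounded1)
    ultimately show ?thesis using mono[of "\<epsilon> / 2"] by linarith
  qed
  then show "split_ratio \<epsilon> * real n \<le> real (top_levels \<epsilon> n)"
    using half unfolding top_levels_def of_nat_max of_nat_min of_nat_1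
    by (elim disjE) (auto simp: max_def min_def)
  show "split_ratio \<epsilon> * real n \<le> real (n - top_levels \<epsilon> n)"
  proof -
    have "split_ratio \<epsilon> \<le> 1 - \<epsilon>" unfolding split_ratio_def by (meson min.cobounded1 min.cobounded2 order_trans)
    then show ?thesis using bottom_levels_ge[OF assms] half mono[of "1 - \<epsilon>"] by fastforce
  qed
qed

text \<open>The nodes inspected on the way from the root to \<open>p\<close>: the nodes on the path and their siblings.\<close>

definition zone :: "dir list \<Rightarrow> dir list set" where
  "zone p = {q. length q \<le> length p \<and> butlast q = take (length q - 1) p}"

lemma zone_take: "k \<le> length p \<Longrightarrow> take k p \<in> zone p"
  by (simp add: zone_def butlast_take)

text \<open>The number of levels of the layout part that contains the leaves when parts of more than
  \<open>m\<close> levels are split further. Only bottom parts are followed, as the leaves lie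
  there.\<close>

function leaf_levels :: "real \<Rightarrow> nat \<Rightarrow> nat \<Rightarrow> nat" where
  "leaf_levels \<epsilon> m n = (if n \<le> max 1 m then n else leaf_levels \<epsilon> m (n - top_levels \<epsilon> n))"
  by auto
termination
  by (relation "measure (\<lambda>(\<epsilon>, m, n). n)") (auto simp: top_levels_def)

declare leaf_levels.simps [simp del]

lemma leaf_levels_le: "leaf_levels \<epsilon> m n \<le> n"
proof (induction n rule: less_induct)
  case (less n)
  show ?case
  proof (cases "n \<le> max 1 m")
    case False
    then have "n - top_levels \<epsilon> n < n" by (auto simp: top_levels_def)
    then show ?thesis using less[of "n - top_levels \<epsilon> n"] False leaf_levels.simps[of \<epsilon> m n] by simp
  qed (simp add: leaf_levels.simps)
qed

lemma leaf_levels_pos: "1 \<le> n \<Longrightarrow> 1 \<le> leaf_levels \<epsilon> m n"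
proof (induction n rule: less_induct)
  case (less n)
  show ?case
  proof (cases "n \<le> max 1 m")
    case False
    then have "n - top_levels \<epsilon> n < n" "1 \<le> n - top_levels \<epsilon> n" by (auto simp: top_levels_def)
    then show ?thesis using less.IH[of "n - top_levels \<epsilon> n"] False leaf_levels.simps[of \<epsilon> m n] by simp
  qed (use less in \<open>simp add: leaf_levels.simps\<close>)
qed

text \<open>The last split applies to a part with at least \<open>m + 1\<close> levels and either
  keeps the share \<open>1 - \<epsilon>\<close> of them or loses a single level; the
  \<open>- 1\<close> covers the second case.\<close>

lemma leaf_levels_ge:
  assumes "0 < \<epsilon>" and "\<epsilon> < 1" and "1 \<le> m" and "m < n"
  shows "(1 - \<epsilon>) * (real m + 1) - 1 \<le> real (leaf_levels \<epsilon> m n)"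
  using assms(4)
proof (induction n rule: less_induct)
  case (less n)
  have n: "2 \<le> n" using less.prems assms(3) by simp
  let ?n = "n - top_levels \<epsilon> n"
  have eq: "leaf_levels \<epsilon> m n = leaf_levels \<epsilon> m ?n"
    using less.prems assms(3) leaf_levels.simps[of \<epsilon> m n] by simp
  show ?case
  proof (cases "m < ?n")
    case True
    then show ?thesis using less.IH[of ?n] eq top_levels_bounds[OF n, of \<epsilon>] by simp
  next
    case False
    have a: "(1 - \<epsilon>) * (real m + 1) \<le> (1 - \<epsilon>) * real n"
      using assms less.prems by (intro mult_left_mono) auto
    have b: "(1 - \<epsilon>) * (real m + 1) \<le> real m + 1"
      using assms mult_right_mono[of "1 - \<epsilon>" 1 "real m + 1"] by simp
    have "(1 - \<epsilon>) * (real m + 1) - 1 \<le> real ?n"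
    proof (cases "top_levels \<epsilon> n = 1")
      case True
      then have "real ?n = real n - 1" using n by (simp add: of_nat_diff)
      moreover have "real m + 1 \<le> real n" using less.prems by simp
      ultimately show ?thesis using b by linarith
    qed (use a bottom_levels_ge[OF assms(1,2) n] in linarith)
    moreover have "leaf_levels \<epsilon> m ?n = ?n" using False by (simp add: leaf_levels.simps)
    ultimately show ?thesis using eq by simp
  qed
qed

text \<open>The \<open>+ 3\<close> makes the count additive over a split: the covers of the two
  parts and three extra windows give \<open>card I + 3 \<le> (card I1 + 3) + (card I2 + 3)\<close>.
  Both parts have at least \<open>split_ratio \<epsilon> * m\<close> levels, so each maximum is
  attained by the number of levels, and these add up to \<open>n\<close>. One cover serves all paths
  that agree above the part with the leaves, because a part of at most \<open>m\<close> levels is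
  covered as a whole.\<close>

lemma veb_cover:
  fixes \<epsilon> :: real
  assumes "0 < \<epsilon>" and "\<epsilon> < 1" and "1 \<le> m" and "ternary_size m \<le> B"
    and "1 \<le> n" and "length p = n - 1"
  shows "\<exists>I. finite I \<and>
    (real (card I) + 3) * (split_ratio \<epsilon> * real m) \<le> 4 * max (real n) (split_ratio \<epsilon> * real m) \<and>
    (\<forall>p' q. length p' = n - 1 \<longrightarrow>
       take (n - leaf_levels \<epsilon> m n) p' = take (n - leaf_levels \<epsilon> m n) p \<longrightarrow>
       q \<in> zone p' \<longrightarrow> (\<exists>a\<in>I. a \<le> veb_pos \<epsilon> n q \<and> veb_pos \<epsilon> n q < a + B))"
  using assms(5,6)
proof (induction n arbitrary: p rule: less_induct)
  case (less n)
  let ?\<delta> = "split_ratio \<epsilon> * real m"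
  have \<delta>: "0 < ?\<delta>" using split_ratio_bounds[OF assms(1,2)] assms(3) by simp
  show ?case
  proof (cases "n \<le> m")
    case True
    have "veb_pos \<epsilon> n q < 0 + B" if "q \<in> zone p'" "length p' = n - 1" for p' q
    proof -
      have "length q < n" using that less.prems by (auto simp: zone_def)
      then show ?thesis using veb_pos_less[of q n \<epsilon>] ternary_size_mono[OF True] assms(4) by simp
    qed
    then show ?thesis by (intro exI[of _ "{0}"]) auto
  next
    case False
    then have n: "2 \<le> n" "m < n" using assms(3) by simp_all
    define t where "t = top_levels \<epsilon> n"
    have t: "1 \<le> t" "t < n" using top_levels_bounds[OF n(1)] by (auto simp: t_def)
    have ge: "?\<delta> \<le> real t" "?\<delta> \<le> real (n - t)"
    proof -
      have "?\<delta> \<le> split_ratio \<epsilon> * real n"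
        using n split_ratio_bounds[OF assms(1,2)] by (intro mult_left_mono) auto
      then show "?\<delta> \<le> real t" "?\<delta> \<le> real (n - t)"
        using part_levels_ge[OF assms(1,2) n(1)] unfolding t_def by linarith+
    qed
    have "length (take (t - 1) p) = t - 1" using t less.prems by simp
    note len1 = this
    obtain I1 where I1: "finite I1" "(real (card I1) + 3) * ?\<delta> \<le> 4 * max (real t) ?\<delta>"
      and c1': "\<forall>p' q. length p' = t - 1 \<longrightarrow>
        take (t - leaf_levels \<epsilon> m t) p' = take (t - leaf_levels \<epsilon> m t) (take (t - 1) p) \<longrightarrow>
        q \<in> zone p' \<longrightarrow> (\<exists>a\<in>I1. a \<le> veb_pos \<epsilon> t q \<and> veb_pos \<epsilon> t q < a + B)"
      using less.IH[OF t(2,1) len1] by (elim exE conjE)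
    have c1: "\<exists>a\<in>I1. a \<le> veb_pos \<epsilon> t q \<and> veb_pos \<epsilon> t q < a + B" if "q \<in> zone (take (t - 1) p)" for q
      using c1'[rule_format, OF len1 refl that] .
    define k where "k = leaf_levels \<epsilon> m n"
    have k: "k = leaf_levels \<epsilon> m (n - t)"
      using n assms(3) leaf_levels.simps[of \<epsilon> m n] by (simp add: t_def k_def)
    have k_le: "k \<le> n - t" unfolding k by (rule leaf_levels_le)
    have bot: "n - t < n" "1 \<le> n - t" "length (drop t p) = n - t - 1" using t less.prems by simp_all
    obtain I2 where I2: "finite I2" "(real (card I2) + 3) * ?\<delta> \<le> 4 * max (real (n - t)) ?\<delta>"
      and c2: "\<forall>p' q. length p' = n - t - 1 \<longrightarrow> take (n - t - k) p' = take (n - t - k) (drop t p) \<longrightarrow>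
        q \<in> zone p' \<longrightarrow> (\<exists>a\<in>I2. a \<le> veb_pos \<epsilon> (n - t) q \<and> veb_pos \<epsilon> (n - t) q < a + B)"
      using less.IH[OF bot, folded k] by (elim exE conjE)
    define off where "off = ternary_size t + path_index (take t p) * ternary_size (n - t)"
    \<comment> \<open>The zone nodes at depth \<open>t\<close> are the root of the bottom part
      entered and its siblings. The siblings are roots of bottom parts that are not entered, so each
      of the three gets its own window.\<close>
    define I3 where "I3 = (\<lambda>d. veb_pos \<epsilon> n (take (t - 1) p @ [d])) ` {Left, Right, Upper}"
    define I where "I = I1 \<union> (+) off ` I2 \<union> I3"
    have "card I3 \<le> card {Left, Right, Upper}" unfolding I3_def by (intro card_image_le) simp
    then have "card I3 \<le> 3" by simp
    moreover have "card I \<le> card I1 + card ((+) off ` I2) + card I3"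
      unfolding I_def by (meson card_Un_le add_le_mono1 order_trans)
    moreover have "card ((+) off ` I2) \<le> card I2" using I2 by (intro card_image_le)
    ultimately have "real (card I) + 3 \<le> (real (card I1) + 3) + (real (card I2) + 3)" by linarith
    then have "(real (card I) + 3) * ?\<delta> \<le> ((real (card I1) + 3) + (real (card I2) + 3)) * ?\<delta>"
      using \<delta> by (intro mult_right_mono) auto
    also have "\<dots> \<le> 4 * real t + 4 * real (n - t)"
      using I1(2) I2(2) ge by (simp add: distrib_right max_def split: if_splits)
    also have "\<dots> = 4 * real n" using t by simp
    finally have card: "(real (card I) + 3) * ?\<delta> \<le> 4 * max (real n) ?\<delta>" by simp
    have "\<exists>a\<in>I. a \<le> veb_pos \<epsilon> n q \<and> veb_pos \<epsilon> n q < a + B"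
      if p': "length p' = n - 1" "take (n - k) p' = take (n - k) p" and q: "q \<in> zone p'" for p' q
    proof -
      \<comment> \<open>The part with the leaves starts at depth \<open>n - k \<ge> t\<close>, so
        all paths considered run through the same top part and enter the same bottom part.\<close>
      have same: "take j p' = take j p" if "j \<le> t" for j
      proof -
        have "j \<le> n - k" using that k_le t by simp
        then show ?thesis using p'(2) by (metis min.absorb2 take_take min.commute)
      qed
      have bl: "butlast q = take (length q - 1) p'" and len: "length q < n"
        using q p' t by (auto simp: zone_def)
      consider "length q < t" | "length q = t" | "t < length q" by linarith
      then show ?thesis
      proof cases
        case 1
        then have "q \<in> zone (take (t - 1) p)"
          using bl same[of "length q - 1"] less.prems t by (auto simp: zone_def min_def)
        then show ?thesis using c1[of q] veb_pos_top[OF n(1), of q \<epsilon>] 1 by (auto simp: I_def t_def)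
      next
        case 2
        then have "q \<noteq> []" using t by auto
        then have "q = take (t - 1) p @ [last q]"
          using bl same[of "t - 1"] 2 by (metis append_butlast_last_id diff_le_self)
        moreover have "last q \<in> {Left, Right, Upper}" by (cases "last q") auto
        ultimately have "veb_pos \<epsilon> n q \<in> I" unfolding I_def I3_def by auto
        moreover have "0 < B" using assms(3,4) ternary_size_mono[of 1 m] by (simp add: ternary_size_def)
        ultimately show ?thesis by force
      next
        case 3
        have "butlast (drop t q) = drop t (butlast q)" using 3 by (simp add: butlast_drop)
        also have "\<dots> = take (length q - 1 - t) (drop t p')" unfolding bl by (simp add: drop_take)
        finally have "drop t q \<in> zone (drop t p')" using q by (auto simp: zone_def diff_commute)
        moreover have "take (n - t - k) (drop t p') = take (n - t - k) (drop t p)"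
          using p'(2) k_le t by (metis diff_commute drop_take)
        ultimately obtain a where a: "a \<in> I2" "a \<le> veb_pos \<epsilon> (n - t) (drop t q)"
          "veb_pos \<epsilon> (n - t) (drop t q) < a + B"
          using c2[rule_format, of "drop t p'" "drop t q"] p'(1) by auto
        have "take t q = take t (butlast q)" using 3 by (simp add: take_butlast)
        also have "\<dots> = take t p" unfolding bl using 3 same[of t] by (simp add: min_absorb1)
        finally have "veb_pos \<epsilon> n q = off + veb_pos \<epsilon> (n - t) (drop t q)"
          using veb_pos_bottom[OF n(1) t_def, of q] 3 by (simp add: off_def)
        then show ?thesis using a unfolding I_def by (intro bexI[of _ "off + a"]) auto
      qed
    qed
    then show ?thesis using card I1 I2 unfolding k_def[symmetric]
      by (intro exI[of _ I]) (auto simp: I_def I3_def)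
  qed
qed

text \<open>The layout will be cut into parts of at most \<open>m\<close> levels. Here
  \<open>B\<close> counts records while a memory block has \<open>B\<close> cells; the difference is
  the constant factor \<open>s\<close>.\<close>

lemma ternary_levels:
  assumes "1 \<le> B"
  obtains m where "1 \<le> m" and "ternary_size m \<le> B" and "B < ternary_size (Suc m)"
proof -
  have "B < 2 ^ B" by (rule less_exp)
  also have "\<dots> \<le> (3::nat) ^ B" by (rule power_mono) auto
  finally have "B < ternary_size (Suc B)" using ternary_size_closed[of "Suc B"] by simp
  define k where "k = (LEAST k. B < ternary_size k)"
  have k: "B < ternary_size k" unfolding k_def by (rule LeastI) (rule \<open>B < ternary_size (Suc B)\<close>)
  have "ternary_size 1 = 1" "ternary_size 0 = 0" by (simp_all add: ternary_size_def)
  then have "k \<noteq> 0" "k \<noteq> 1" using k assms by (metis not_less0, metis leD)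
  then obtain m where m: "k = Suc m" "1 \<le> m" by (cases k) auto
  have "\<not> B < ternary_size m" using not_less_Least[of m "\<lambda>k. B < ternary_size k"] m k_def by simp
  then show ?thesis using that[of m] m k by simp
qed


section \<open>Shape of the ST-trees\<close>

text \<open>The root of \<open>t\<close> has height \<open>h\<close> and the rectangle \<open>[x .. x + 2 ^ h - 1] \<times> [y .. Y]\<close>. The row \<open>w\<close>
  is the top of the child covered by the upper child; \<open>N\<close> bounds these rows.\<close>

fun wf_st :: "nat \<Rightarrow> nat \<Rightarrow> nat \<Rightarrow> nat \<Rightarrow> enat \<Rightarrow> 'a st \<Rightarrow> bool" where
  "wf_st N h x y Y (Leaf R pt a) \<longleftrightarrow> h = 0 \<and> R = Rect x x y Y"
| "wf_st N h x y Y (Bin R l r) \<longleftrightarrow> (\<exists>g. h = Suc g \<and> R = Rect x (x + 2 ^ h - 1) y Y \<and>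
     wf_st N g x y Y l \<and> wf_st N g (x + 2 ^ g) y Y r)"
| "wf_st N h x y Y (Tri R l r u) \<longleftrightarrow> (\<exists>g w. h = Suc g \<and> R = Rect x (x + 2 ^ h - 1) y Y \<and>
     y \<le> Suc w \<and> w \<le> N \<and> enat w \<le> Y \<and>
     (wf_st N g x y (enat w) l \<and> wf_st N g (x + 2 ^ g) y Y r \<and> wf_st N g x (Suc w) Y u \<or>
      wf_st N g x y Y l \<and> wf_st N g (x + 2 ^ g) y (enat w) r \<and> wf_st N g (x + 2 ^ g) (Suc w) Y u))"

lemma wf_st_rect: "wf_st N h x y Y t \<Longrightarrow> rect_of t = Rect x (x + 2 ^ h - 1) y Y"
  by (cases t) auto

lemma wf_st_cells:
  "wf_st N h x y Y t \<Longrightarrow>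
   (i, v) \<in> cells_of (rect_of t) \<longleftrightarrow> x \<le> i \<and> i < x + 2 ^ h \<and> y \<le> v \<and> enat v \<le> Y"
proof -
  have "0 < (2::nat) ^ h" by simp
  then have "i \<le> x + 2 ^ h - 1 \<longleftrightarrow> i < x + 2 ^ h" by linarith
  then show "wf_st N h x y Y t \<Longrightarrow> ?thesis" by (simp add: wf_st_rect cells_of_def)
qed

lemma wf_st_height: "wf_st N h x y Y t \<Longrightarrow> st_height t = h"
  by (induction t arbitrary: h x y Y) auto

lemma wf_st_mono: "wf_st N h x y Y t \<Longrightarrow> N \<le> N' \<Longrightarrow> wf_st N' h x y Y t"
proof (induction t arbitrary: h x y Y)
  case (Tri R l r u)
  then show ?case unfolding wf_st.simps(3) by (blast intro: le_trans)
qed auto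

text \<open>Below a closed root every rectangle is closed, since each top side is inherited from the
  parent or is a finite row \<open>w\<close>.\<close>

lemma close_closed: "wf_st N h x y (enat Y) t \<Longrightarrow> close V t = t"
proof (induction t arbitrary: h x y Y)
  case (Bin R l r)
  then show ?case by (fastforce simp: close_rect_def)
next
  case (Tri R l r u)
  then show ?case by (fastforce simp: close_rect_def)
qed (simp add: close_rect_def)

lemma wf_st_close: "wf_st N h x y \<infinity> t \<Longrightarrow> N \<le> V \<Longrightarrow> wf_st V h x y (enat V) (close V t)"
proof (induction t arbitrary: h x y)
  case (Bin R l r)
  then show ?case by (auto simp: close_rect_def)
next
  case (Tri R l r u)
  from Tri.prems obtain g w where g: "h = Suc g" "R = Rect x (x + 2 ^ h - 1) y \<infinity>" "y \<le> Suc w" "w \<le> N"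
    and c: "wf_st N g x y (enat w) l \<and> wf_st N g (x + 2 ^ g) y \<infinity> r \<and> wf_st N g x (Suc w) \<infinity> u \<or>
      wf_st N g x y \<infinity> l \<and> wf_st N g (x + 2 ^ g) y (enat w) r \<and> wf_st N g (x + 2 ^ g) (Suc w) \<infinity> u"
    by auto
  have "wf_st V g x' y' (enat w) (close V t)" if "wf_st N g x' y' (enat w) t" for x' y' and t :: "'a st"
    using that close_closed[OF that] wf_st_mono[OF that] Tri.prems by simp
  then have "wf_st V g x y (enat w) (close V l) \<and> wf_st V g (x + 2 ^ g) y (enat V) (close V r) \<and> wf_st V g x (Suc w) (enat V) (close V u) \<or>
      wf_st V g x y (enat V) (close V l) \<and> wf_st V g (x + 2 ^ g) y (enat w) (close V r) \<and> wf_st V g (x + 2 ^ g) (Suc w) (enat V) (close V u)"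
    using c Tri.IH Tri.prems(2) by blast
  then show ?case using g Tri.prems(2) by (auto simp: close_rect_def)
qed (simp add: close_rect_def)

lemma wf_st_complete_tree: "wf_st N h x y \<infinity> (complete_tree C h x y)"
  by (induction h arbitrary: x y) auto

lemma wf_st_on_top:
  "wf_st N h x y Y t \<Longrightarrow> wf_st N' h x (Suc V) \<infinity> (on_top C V t)"
  by (simp add: on_top_def wf_st_height wf_st_rect wf_st_complete_tree)

text \<open>The new point is in row \<open>Suc N\<close>, above every row at which a covered child
  ends. It therefore never falls into a covered child, and its search path runs through open
  rectangles only.\<close>

lemma wf_st_add_point:
  assumes "wf_st N h x y \<infinity> t" and "(i, Suc N) \<in> cells_of (rect_of t)"
  shows "wf_st (Suc N) h x y \<infinity> (fst (add_point C (Suc N) i a t))"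
  using assms
proof (induction t arbitrary: h x y)
  case (Leaf R pt b)
  then show ?case by simp
next
  case (Bin R l r)
  from Bin.prems(1) obtain g where g: "h = Suc g" "R = Rect x (x + 2 ^ h - 1) y \<infinity>"
    and l: "wf_st N g x y \<infinity> l" and r: "wf_st N g (x + 2 ^ g) y \<infinity> r"
    by auto
  have iv: "x \<le> i" "i < x + 2 ^ h" "y \<le> Suc N"
    using Bin.prems wf_st_cells by blast+
  have l': "wf_st (Suc N) g x y \<infinity> l" and r': "wf_st (Suc N) g (x + 2 ^ g) y \<infinity> r"
    using l r by (auto intro: wf_st_mono)
  show ?case
  proof (cases "(i, Suc N) \<in> cells_of (rect_of l)")
    case True
    obtain l1 full where l1: "add_point C (Suc N) i a l = (l1, full)" by fastforce
    have wf: "wf_st (Suc N) g x y \<infinity> l1" using Bin.IH(1)[OF l True] l1 by simp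
    \<comment> \<open>If \<open>l1\<close> has become full, it is closed at the row of the Write
      itself, so \<open>Suc N\<close> is the row below the upper child.\<close>
    show ?thesis
      using True l1 g wf r' iv wf_st_close[OF wf le_refl] wf_st_on_top[OF wf_st_close[OF wf le_refl]]
        wf_st_on_top[OF wf] by (auto intro!: exI[of _ "Suc N"])
  next
    case False
    then have "(i, Suc N) \<in> cells_of (rect_of r)"
      using iv g(1) wf_st_cells[OF l] wf_st_cells[OF r] by auto
    obtain r1 full where r1: "add_point C (Suc N) i a r = (r1, full)" by fastforce
    have wf: "wf_st (Suc N) g (x + 2 ^ g) y \<infinity> r1" using Bin.IH(2)[OF r] \<open>_ \<in> cells_of (rect_of r)\<close> r1 by simp
    show ?thesis
      using False r1 g wf l' iv wf_st_close[OF wf le_refl] wf_st_on_top[OF wf_st_close[OF wf le_refl]]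
        wf_st_on_top[OF wf] by (auto intro!: exI[of _ "Suc N"])
  qed
next
  case (Tri R l r u)
  from Tri.prems(1) obtain g w where g: "h = Suc g" "R = Rect x (x + 2 ^ h - 1) y \<infinity>" "y \<le> Suc w" "w \<le> N"
    and c: "wf_st N g x y (enat w) l \<and> wf_st N g (x + 2 ^ g) y \<infinity> r \<and> wf_st N g x (Suc w) \<infinity> u \<or>
      wf_st N g x y \<infinity> l \<and> wf_st N g (x + 2 ^ g) y (enat w) r \<and> wf_st N g (x + 2 ^ g) (Suc w) \<infinity> u"
    by auto
  have iv: "x \<le> i" "i < x + 2 ^ h" "y \<le> Suc N"
    using Tri.prems wf_st_cells by blast+
  have mono: "wf_st (Suc N) g x' y' Y t" if "wf_st N g x' y' Y t" for x' y' Y and t :: "'a st"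
    using that by (auto intro: wf_st_mono)
  obtain l1 fl r1 fr u1 fu where eqs: "add_point C (Suc N) i a l = (l1, fl)"
    "add_point C (Suc N) i a r = (r1, fr)" "add_point C (Suc N) i a u = (u1, fu)"
    by (metis surj_pair)
  from c show ?case
  proof
    assume c: "wf_st N g x y (enat w) l \<and> wf_st N g (x + 2 ^ g) y \<infinity> r \<and> wf_st N g x (Suc w) \<infinity> u"
    then have l: "(i, Suc N) \<notin> cells_of (rect_of l)" using g wf_st_cells by fastforce
    show ?thesis
    proof (cases "(i, Suc N) \<in> cells_of (rect_of r)")
      case True
      then have "wf_st (Suc N) g (x + 2 ^ g) y \<infinity> r1" using Tri.IH(2) c eqs by (metis fst_conv)
      then show ?thesis using l True eqs g c mono by (auto intro!: exI[of _ w])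
    next
      case False
      then have "(i, Suc N) \<in> cells_of (rect_of u)"
        using c iv g wf_st_cells[of N g _ _ _ r] wf_st_cells[of N g _ _ _ u] by fastforce
      then have "wf_st (Suc N) g x (Suc w) \<infinity> u1" using Tri.IH(3) c eqs by (metis fst_conv)
      then show ?thesis using l False eqs g c mono by (auto intro!: exI[of _ w])
    qed
  next
    assume c: "wf_st N g x y \<infinity> l \<and> wf_st N g (x + 2 ^ g) y (enat w) r \<and> wf_st N g (x + 2 ^ g) (Suc w) \<infinity> u"
    then have r: "(i, Suc N) \<notin> cells_of (rect_of r)" using g wf_st_cells by fastforce
    show ?thesis
    proof (cases "(i, Suc N) \<in> cells_of (rect_of l)")
      case True
      then have "wf_st (Suc N) g x y \<infinity> l1" using Tri.IH(1) c eqs by (metis fst_conv)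
      then show ?thesis using r True eqs g c mono by (auto intro!: exI[of _ w])
    next
      case False
      then have "(i, Suc N) \<in> cells_of (rect_of u)"
        using c iv g wf_st_cells[of N g _ _ _ l] wf_st_cells[of N g _ _ _ u] by fastforce
      then have "wf_st (Suc N) g (x + 2 ^ g) (Suc w) \<infinity> u1" using Tri.IH(3) c eqs by (metis fst_conv)
      then show ?thesis using r False eqs g c mono by (auto intro!: exI[of _ w])
    qed
  qed
qed

section \<open>Invariant of the whole persistent structure\<close>

definition tree_top :: "nat \<Rightarrow> nat \<Rightarrow> nat \<Rightarrow> enat" where
  "tree_top n U j = (if Suc j = n then \<infinity> else enat (Suc j * U))"

text \<open>The two bounds on \<open>V_of D\<close> say that the number of trees is
  \<open>V / U\<close> rounded up. The bound on the logged addresses is what permits replaying the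
  log with a larger \<open>U\<close>.\<close>

definition valid_pds :: "'a pds \<Rightarrow> bool" where
  "valid_pds D \<longleftrightarrow> (\<forall>(i, x)\<in>set (wlog D). 1 \<le> i \<and> i \<le> U_of D) \<and>
     V_of D \<le> length (trees D) * U_of D \<and>
     (\<forall>j. length (trees D) = Suc j \<longrightarrow> j * U_of D < V_of D) \<and>
     (\<forall>j<length (trees D). wf_st (V_of D) (lgU D) 1 (Suc (j * U_of D))
        (tree_top (length (trees D)) (U_of D) j) (trees D ! j))"

lemma write_small_fields:
  "lgU (write_small w D) = lgU D" "wlog (write_small w D) = wlog D @ [w]"
  by (cases w, simp add: write_small_def Let_def)+

lemma valid_pds_write_small:
  assumes "valid_pds D" and "1 \<le> i" and "i \<le> U_of D"
  shows "valid_pds (write_small (i, a) D)"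
proof -
  define U V n where "U = U_of D" and "V = V_of D" and "n = length (trees D)"
  have U: "1 \<le> U" by (simp add: U_def U_of_def)
  define ts where "ts = (if U dvd V
    then map (close V) (trees D) @ [complete_tree (cur D) (lgU D) 1 (Suc V)] else trees D)"
  have V: "V \<le> n * U" "\<And>j. n = Suc j \<Longrightarrow> j * U < V"
    and wf: "\<And>j. j < n \<Longrightarrow> wf_st V (lgU D) 1 (Suc (j * U)) (tree_top n U j) (trees D ! j)"
    using assms(1) by (auto simp: valid_pds_def U_def V_def n_def)
  have "\<exists>m. length ts = Suc m \<and> m * U < Suc V \<and> Suc V \<le> Suc m * U \<and>
    (\<forall>j\<le>m. wf_st V (lgU D) 1 (Suc (j * U)) (tree_top (Suc m) U j) (ts ! j))"
  proof (cases "U dvd V")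
    case True
    then obtain q where q: "V = q * U" by (metis dvd_def mult.commute)
    \<comment> \<open>A new top tree is added exactly when the \<open>n\<close> existing trees are
      used up, so the old top tree is closed at the row that \<open>tree_top\<close> prescribes for
      it.\<close>
    have "q = n"
    proof (rule antisym)
      show "q \<le> n" using V(1) q U by simp
      show "n \<le> q"
      proof (cases n)
        case (Suc j)
        then show ?thesis using V(2)[OF Suc] q U by simp
      qed simp
    qed
    have "wf_st V (lgU D) 1 (Suc (j * U)) (tree_top (Suc n) U j) (ts ! j)" if "j \<le> n" for j
    proof (cases "j = n")
      case True
      then show ?thesis
        using \<open>U dvd V\<close> q \<open>q = n\<close> by (simp add: ts_def tree_top_def nth_append n_def wf_st_complete_tree)
    next
      case False
      then have j: "j < n" using that by simp
      have "wf_st V (lgU D) 1 (Suc (j * U)) (enat (Suc j * U)) (close V (trees D ! j))"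
      proof (cases "Suc j = n")
        case True
        then show ?thesis using wf[OF j] q \<open>q = n\<close> wf_st_close[of V _ _ _ _ V]
          by (simp add: tree_top_def)
      next
        case False
        then have "wf_st V (lgU D) 1 (Suc (j * U)) (enat (Suc j * U)) (trees D ! j)"
          using wf[OF j] by (simp add: tree_top_def)
        then show ?thesis using close_closed by metis
      qed
      then show ?thesis using j \<open>U dvd V\<close> by (simp add: ts_def tree_top_def nth_append n_def)
    qed
    then show ?thesis using True q \<open>q = n\<close> U by (intro exI[of _ n]) (simp add: ts_def n_def)
  next
    case False
    then have "n \<noteq> 0" using V(1) by (intro notI) simp
    then obtain m where m: "n = Suc m" by (cases n) auto
    have "V \<noteq> n * U" using False by auto
    then have "V < Suc m * U" using V(1) m by simp
    then show ?thesis using False V(2)[OF m] wf m by (intro exI[of _ m]) (simp add: ts_def n_def)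
  qed
  then obtain m where m: "length ts = Suc m" "m * U < Suc V" "Suc V \<le> Suc m * U"
    and wf': "\<And>j. j \<le> m \<Longrightarrow> wf_st V (lgU D) 1 (Suc (j * U)) (tree_top (Suc m) U j) (ts ! j)"
    by blast
  let ?C = "(cur D)(i := a)"
  let ?t = "fst (add_point ?C (Suc V) i a (last ts))"
  have "ts \<noteq> []" using m(1) by auto
  then have last: "last ts = ts ! m" using m(1) by (simp add: last_conv_nth)
  have wfl: "wf_st V (lgU D) 1 (Suc (m * U)) \<infinity> (last ts)"
    using wf'[of m] by (simp add: last tree_top_def)
  have "(i, Suc V) \<in> cells_of (rect_of (last ts))"
    using assms(2,3) m(2) by (simp add: wf_st_cells[OF wfl] U_def U_of_def)
  then have new: "wf_st (Suc V) (lgU D) 1 (Suc (m * U)) \<infinity> ?t" by (rule wf_st_add_point[OF wfl])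
  have eq: "trees (write_small (i, a) D) = butlast ts @ [?t]" "lgU (write_small (i, a) D) = lgU D"
    "wlog (write_small (i, a) D) = wlog D @ [(i, a)]"
    by (simp_all add: write_small_def Let_def ts_def U_def V_def)
  then have U': "U_of (write_small (i, a) D) = U" and V': "V_of (write_small (i, a) D) = Suc V"
    by (simp_all add: U_def U_of_def V_def V_of_def)
  have len: "length (trees (write_small (i, a) D)) = Suc m" using eq m by simp
  have "wf_st (Suc V) (lgU D) 1 (Suc (j * U)) (tree_top (Suc m) U j) ((butlast ts @ [?t]) ! j)"
    if "j < Suc m" for j
  proof (cases "j = m")
    case True
    then show ?thesis using new m(1) by (simp add: nth_append tree_top_def)
  next
    case False
    then show ?thesis
      using that wf'[of j] m(1) wf_st_mono[of V _ _ _ _ _ "Suc V"] by (simp add: nth_append nth_butlast)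
  qed
  then show ?thesis
    unfolding valid_pds_def len U' V' unfolding eq
    using assms m by (auto simp: valid_pds_def U_def)
qed

lemma valid_pds_empty: "valid_pds (empty_pds k)"
  by (simp add: valid_pds_def empty_pds_def V_of_def)

lemma valid_pds_rebuild:
  assumes "\<forall>(i, x)\<in>set ws. 1 \<le> i \<and> i \<le> 2 ^ k"
  shows "valid_pds (rebuild k ws) \<and> lgU (rebuild k ws) = k \<and> wlog (rebuild k ws) = ws"
  using assms
proof (induction ws rule: rev_induct)
  case Nil
  then show ?case using valid_pds_empty by (simp add: rebuild_def empty_pds_def)
next
  case (snoc w ws)
  moreover have "rebuild k (ws @ [w]) = write_small w (rebuild k ws)" by (simp add: rebuild_def)
  ultimately show ?case
    using valid_pds_write_small[of "rebuild k ws" "fst w" "snd w"]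
    by (auto simp: write_small_fields U_of_def)
qed

lemma valid_pds_write:
  assumes "valid_pds D" and "1 \<le> i"
  shows "valid_pds (pds_write (i, a) D)"
proof (cases "U_of D < i")
  case True
  define k where "k = (LEAST k. i \<le> 2 ^ k)"
  have "i \<le> 2 ^ i" using less_exp[of i] by simp
  then have k: "i \<le> 2 ^ k" unfolding k_def by (rule LeastI)
  \<comment> \<open>Logged addresses are at most the old \<open>U\<close>, hence smaller than
    \<open>i\<close>.\<close>
  then have "\<forall>(i, x)\<in>set (wlog D). 1 \<le> i \<and> i \<le> 2 ^ k"
    using True assms(1) by (fastforce simp: valid_pds_def)
  from valid_pds_rebuild[OF this] k assms show ?thesis
    using True by (auto simp: pds_write_def k_def[symmetric] U_of_def intro!: valid_pds_write_small)
next
  case False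
  then show ?thesis using assms by (auto simp: pds_write_def intro!: valid_pds_write_small)
qed

lemma valid_pds_after_writes: "\<forall>(i, x)\<in>set ws. 1 \<le> i \<Longrightarrow> valid_pds (after_writes ws)"
proof (induction ws rule: rev_induct)
  case (snoc w ws)
  then show ?case using valid_pds_write[of "after_writes ws" "fst w" "snd w"]
    by (auto simp: after_writes_def)
qed (simp add: after_writes_def valid_pds_empty)

text \<open>One tree serves all columns of a version because trees span the full width. Uniqueness
  identifies the result of the \<open>LEAST\<close> search and makes a climb in any other tree fail
  at its root.\<close>

definition version_tree :: "'a pds \<Rightarrow> nat \<Rightarrow> nat \<Rightarrow> bool" where
  "version_tree D v j \<longleftrightarrow> j < length (trees D) \<and>
     (\<forall>i. 1 \<le> i \<longrightarrow> i \<le> U_of D \<longrightarrow> (i, v) \<in> cells_of (rect_of (trees D ! j))) \<and>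
     (\<forall>i k. k < length (trees D) \<longrightarrow> (i, v) \<in> cells_of (rect_of (trees D ! k)) \<longrightarrow> k = j)"

lemma ex_version_tree:
  assumes "valid_pds D" and "1 \<le> v" and "v \<le> V_of D"
  shows "\<exists>j. version_tree D v j"
proof -
  define U where "U = U_of D"
  have U: "1 \<le> U" by (simp add: U_def U_of_def)
  define j where "j = (v - 1) div U"
  have "v - 1 < length (trees D) * U" using assms by (auto simp: valid_pds_def U_def)
  then have j: "j < length (trees D)" unfolding j_def by (rule less_mult_imp_div_less)
  have v: "j * U < v" "v \<le> Suc j * U"
  proof -
    show "j * U < v" using assms(2) div_times_less_eq_dividend[of "v - 1" U] unfolding j_def by linarith
    show "v \<le> Suc j * U" using assms(2) dividend_less_div_times[of U "v - 1"] U unfolding j_def by simp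
  qed
  have cells: "(i, v) \<in> cells_of (rect_of (trees D ! k)) \<longleftrightarrow>
    1 \<le> i \<and> i \<le> U \<and> k * U < v \<and> enat v \<le> tree_top (length (trees D)) U k" if "k < length (trees D)" for i k
  proof -
    have "wf_st (V_of D) (lgU D) 1 (Suc (k * U)) (tree_top (length (trees D)) U k) (trees D ! k)"
      using assms(1) that by (auto simp: valid_pds_def U_def)
    from wf_st_cells[OF this] show ?thesis by (auto simp: U_def U_of_def)
  qed
  show ?thesis
    unfolding version_tree_def
  proof (intro exI[of _ j] conjI allI impI j)
    show "(i, v) \<in> cells_of (rect_of (trees D ! j))" if "1 \<le> i" "i \<le> U_of D" for i
      using that v by (simp add: cells[OF j] tree_top_def U_def)
    show "k = j" if k: "k < length (trees D)" "(i, v) \<in> cells_of (rect_of (trees D ! k))" for i k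
    proof (rule antisym)
      have kv: "k * U < v" using k cells by blast
      then have "k * U < Suc j * U" using v by linarith
      then show "k \<le> j" using mult_less_cancel2 by (metis less_Suc_eq_le)
      show "j \<le> k"
      proof (rule ccontr)
        assume "\<not> j \<le> k"
        then have "Suc k \<noteq> length (trees D)" "Suc k * U \<le> j * U"
          using j mult_le_mono1[of "Suc k" j U] by auto
        moreover have "enat v \<le> tree_top (length (trees D)) U k" using k cells by blast
        ultimately show False using v by (simp add: tree_top_def)
      qed
    qed
  qed
qed


section \<open>Search paths\<close>

lemma zone_Cons: "r \<in> zone p \<Longrightarrow> d # r \<in> zone (d # p)"
  by (cases r rule: rev_cases) (auto simp: zone_def)

lemma zone_child: "[d'] \<in> zone (d # p)"
  by (simp add: zone_def)

lemma zone_append: "r \<in> zone p \<Longrightarrow> q @ r \<in> zone (q @ p)"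
  by (induction q) (auto intro: zone_Cons)

lemma finite_zone: "finite (zone p)"
proof -
  have "zone p \<subseteq> {q. set q \<subseteq> {Left, Right, Upper} \<and> length q \<le> length p}"
    by (auto simp: zone_def) (metis digit.cases)
  then show ?thesis by (rule finite_subset) (rule finite_lists_length_le, simp)
qed

text \<open>The path of a search from the root, free of any pointer; reads end at this leaf wherever
  they start.\<close>

fun route :: "nat \<times> nat \<Rightarrow> 'a st \<Rightarrow> dir list" where
  "route q (Leaf R pt a) = []"
| "route q (Bin R l r) =
     (if q \<in> cells_of (rect_of l) then Left # route q l else Right # route q r)"
| "route q (Tri R l r u) =
     (if q \<in> cells_of (rect_of l) then Left # route q l
      else if q \<in> cells_of (rect_of r) then Right # route q r
      else Upper # route q u)"

lemma route_leaf: "route q t \<in> nodes t \<and> is_leaf (subtree t (route q t))"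
  by (induction t) auto

lemma last_child_list: "last ([d] # map ((#) d) ds) = d # last ([] # ds)"
  by (cases ds) (auto simp: last_map)

lemma last_descend: "last ([] # descend q t) = route q t"
proof (induction t)
  case (Bin R l r)
  have "last ([] # descend q (Bin R l r)) = last (descend q (Bin R l r))" by simp
  then show ?case
    using last_child_list[of Left "descend q l"] last_child_list[of Right "descend q r"] Bin.IH
    by (simp only: descend.simps route.simps last_ConsR list.distinct split: if_split) auto
next
  case (Tri R l r u)
  have "last ([] # descend q (Tri R l r u)) = last (descend q (Tri R l r u))" by simp
  then show ?case
    using last_child_list[of Left "descend q l"] last_child_list[of Right "descend q r"]
      last_child_list[of Upper "descend q u"] Tri.IH
    by (simp only: descend.simps route.simps last_ConsR list.distinct split: if_split) auto
qed simp

lemma Nil_in_nodes: "[] \<in> nodes t"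
  by (cases t) auto

lemma descend_nodes: "r \<in> set (descend q t) \<Longrightarrow> r \<in> nodes t \<and> r \<noteq> []"
  by (induction t arbitrary: r) (auto split: if_splits simp: Nil_in_nodes)

lemma descend_zone: "r \<in> set (descend q t) \<Longrightarrow> r \<in> zone (route q t)"
  by (induction t arbitrary: r) (auto split: if_splits intro: zone_Cons zone_child)

text \<open>The order in which the nodes inspected on the way down occur in the layout.\<close>

definition precedes :: "dir list \<Rightarrow> dir list \<Rightarrow> bool" where
  "precedes a b \<longleftrightarrow> (\<exists>u d d' w. a = u @ [d] \<and> b = u @ d' # w \<and>
     (digit d < digit d' \<or> d = d' \<and> w \<noteq> []))"

lemma precedes_append: "precedes a b \<Longrightarrow> precedes (p @ a) (p @ b)"
  unfolding precedes_def by (metis append_assoc)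

lemma precedes_singleton: "precedes [d] (d' # w) \<longleftrightarrow> digit d < digit d' \<or> d = d' \<and> w \<noteq> []"
  unfolding precedes_def by (auto simp: append_eq_Cons_conv Cons_eq_append_conv)

lemma veb_pos_precedes:
  assumes "precedes a b" and "length b < n"
  shows "veb_pos \<epsilon> n a < veb_pos \<epsilon> n b"
proof -
  obtain u d d' w where ab: "a = u @ [d]" "b = (u @ [d']) @ w"
    and c: "digit d < digit d' \<or> d = d' \<and> w \<noteq> []"
    using assms(1) by (auto simp: precedes_def)
  have le: "veb_pos \<epsilon> n (u @ [d']) \<le> veb_pos \<epsilon> n b" if "w = []" using that ab by simp
  have lt: "veb_pos \<epsilon> n (u @ [d']) < veb_pos \<epsilon> n b" if "w \<noteq> []"
    unfolding ab(2) by (rule veb_pos_extend) (use that assms(2) ab in auto)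
  show ?thesis
    using c
  proof
    assume "digit d < digit d'"
    then have "veb_pos \<epsilon> n a < veb_pos \<epsilon> n (u @ [d'])"
      using assms(2) ab by (simp add: veb_pos_sibling)
    then show ?thesis using le lt by (cases "w = []") auto
  qed (use lt ab in auto)
qed

lemma sorted_descend: "sorted_wrt precedes (descend q t)"
proof (induction t)
  case (Leaf R pt a)
  then show ?case by simp
next
  case (Bin R l r)
  have "sorted_wrt precedes (map ((#) d) (descend q t))" if "sorted_wrt precedes (descend q t)"
    for d and t :: "'a st"
    unfolding sorted_wrt_map
    by (rule sorted_wrt_mono_rel[OF _ that]) (use precedes_append[of _ _ "[d]"] in auto)
  then show ?case using Bin.IH by (auto simp: precedes_singleton dest: descend_nodes)
next
  case (Tri R l r u)
  have "sorted_wrt precedes (map ((#) d) (descend q t))" if "sorted_wrt precedes (descend q t)"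
    for d and t :: "'a st"
    unfolding sorted_wrt_map
    by (rule sorted_wrt_mono_rel[OF _ that]) (use precedes_append[of _ _ "[d]"] in auto)
  then show ?case using Tri.IH by (auto simp: precedes_singleton dest: descend_nodes)
qed

section \<open>Nodes, their rectangles and the uniqueness of search paths\<close>

lemma finite_nodes: "finite (nodes t)"
  by (induction t) auto

lemma nodes_append: "p \<in> nodes t \<Longrightarrow> p @ r \<in> nodes t \<longleftrightarrow> r \<in> nodes (subtree t p)"
  by (induction t arbitrary: p) auto

lemma nodes_prefix: "p @ r \<in> nodes t \<Longrightarrow> p \<in> nodes t"
proof (induction t arbitrary: p)
  case (Bin R l r)
  then show ?case by (cases p) (auto simp: Nil_in_nodes)
next
  case (Tri R l r u)
  then show ?case by (cases p) (auto simp: Nil_in_nodes)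
qed simp

lemma nodes_take: "p \<in> nodes t \<Longrightarrow> take k p \<in> nodes t"
  by (metis append_take_drop_id nodes_prefix)

text \<open>Upper children have the same height as their siblings, so all leaves are at depth
  \<open>h\<close> and the tree fits the layout with \<open>h + 1\<close> levels.\<close>

lemma wf_st_nodes:
  assumes "wf_st N h x y Y t" and "p \<in> nodes t"
  shows "length p \<le> h \<and> (is_leaf (subtree t p) \<longrightarrow> length p = h)"
  using assms
proof (induction t arbitrary: h x y Y p)
  case (Bin R l r)
  from Bin.prems(1) obtain g where h: "h = Suc g" and wf: "wf_st N g x y Y l" "wf_st N g (x + 2 ^ g) y Y r"
    by auto
  show ?case using Bin.IH(1)[OF wf(1)] Bin.IH(2)[OF wf(2)] Bin.prems(2) h by auto
next
  case (Tri R l r u)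
  from Tri.prems(1) obtain g w where "h = Suc g"
    "wf_st N g x y (enat w) l \<and> wf_st N g (x + 2 ^ g) y Y r \<and> wf_st N g x (Suc w) Y u \<or>
      wf_st N g x y Y l \<and> wf_st N g (x + 2 ^ g) y (enat w) r \<and> wf_st N g (x + 2 ^ g) (Suc w) Y u"
    by auto
  then obtain x1 y1 Y1 x2 y2 Y2 x3 y3 Y3 where h: "h = Suc g" and wf: "wf_st N g x1 y1 Y1 l"
    "wf_st N g x2 y2 Y2 r" "wf_st N g x3 y3 Y3 u" by blast
  show ?case
    using Tri.IH(1)[OF wf(1)] Tri.IH(2)[OF wf(2)] Tri.IH(3)[OF wf(3)] Tri.prems(2) h by auto
qed auto

lemma wf_st_Tri_cases:
  assumes "wf_st N h x y Y (Tri R l r u)"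
  obtains (left) g w where "h = Suc g" "y \<le> Suc w" "enat w \<le> Y" "wf_st N g x y (enat w) l"
      "wf_st N g (x + 2 ^ g) y Y r" "wf_st N g x (Suc w) Y u"
    | (right) g w where "h = Suc g" "y \<le> Suc w" "enat w \<le> Y" "wf_st N g x y Y l"
      "wf_st N g (x + 2 ^ g) y (enat w) r" "wf_st N g (x + 2 ^ g) (Suc w) Y u"
  using assms by auto

lemma wf_st_partition_Bin:
  assumes "wf_st N h x y Y (Bin R l r)"
  shows "cells_of (rect_of (Bin R l r)) = cells_of (rect_of l) \<union> cells_of (rect_of r)"
    and "cells_of (rect_of l) \<inter> cells_of (rect_of r) = {}"
proof -
  obtain g where g: "h = Suc g" and c: "wf_st N g x y Y l" "wf_st N g (x + 2 ^ g) y Y r"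
    using assms by auto
  note cells = wf_st_cells[OF assms] wf_st_cells[OF c(1)] wf_st_cells[OF c(2)]
  show "cells_of (rect_of (Bin R l r)) = cells_of (rect_of l) \<union> cells_of (rect_of r)"
    by (rule set_eqI) (use g in \<open>auto simp: cells simp del: st.sel\<close>)
  show "cells_of (rect_of l) \<inter> cells_of (rect_of r) = {}"
    by (auto simp: cells)
qed

lemma wf_st_partition_Tri:
  assumes "wf_st N h x y Y (Tri R l r u)"
  shows "cells_of (rect_of (Tri R l r u)) =
      cells_of (rect_of l) \<union> cells_of (rect_of r) \<union> cells_of (rect_of u)"
    and "cells_of (rect_of l) \<inter> cells_of (rect_of r) = {}"
    and "cells_of (rect_of l) \<inter> cells_of (rect_of u) = {}"
    and "cells_of (rect_of r) \<inter> cells_of (rect_of u) = {}"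
proof -
  have "cells_of (rect_of (Tri R l r u)) =
      cells_of (rect_of l) \<union> cells_of (rect_of r) \<union> cells_of (rect_of u) \<and>
    cells_of (rect_of l) \<inter> cells_of (rect_of r) = {} \<and>
    cells_of (rect_of l) \<inter> cells_of (rect_of u) = {} \<and>
    cells_of (rect_of r) \<inter> cells_of (rect_of u) = {}"
    using assms
  proof (cases rule: wf_st_Tri_cases)
    case (left g w)
    note cells = wf_st_cells[OF assms] wf_st_cells[OF left(4)] wf_st_cells[OF left(5)] wf_st_cells[OF left(6)]
    have Y: "enat v \<le> enat w \<Longrightarrow> enat v \<le> Y" for v using left(3) order_trans by blast
    show ?thesis
      using left(1,2) Y by (auto simp: cells set_eq_iff simp del: st.sel)
  next
    case (right g w)
    note cells = wf_st_cells[OF assms] wf_st_cells[OF right(4)] wf_st_cells[OF right(5)] wf_st_cells[OF right(6)]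
    have Y: "enat v \<le> enat w \<Longrightarrow> enat v \<le> Y" for v using right(3) order_trans by blast
    show ?thesis
      using right(1,2) Y by (auto simp: cells set_eq_iff simp del: st.sel)
  qed
  then show "cells_of (rect_of (Tri R l r u)) =
      cells_of (rect_of l) \<union> cells_of (rect_of r) \<union> cells_of (rect_of u)"
    and "cells_of (rect_of l) \<inter> cells_of (rect_of r) = {}"
    and "cells_of (rect_of l) \<inter> cells_of (rect_of u) = {}"
    and "cells_of (rect_of r) \<inter> cells_of (rect_of u) = {}" by blast+
qed

lemma wf_st_children:
  shows "wf_st N h x y Y (Bin R l r) \<Longrightarrow> (\<exists>h x y Y. wf_st N h x y Y l) \<and> (\<exists>h x y Y. wf_st N h x y Y r)"
    and "wf_st N h x y Y (Tri R l r u) \<Longrightarrow> (\<exists>h x y Y. wf_st N h x y Y l) \<and> (\<exists>h x y Y. wf_st N h x y Y r) \<and>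
      (\<exists>h x y Y. wf_st N h x y Y u)"
  by auto

lemma subtree_cells:
  assumes "wf_st N h x y Y t" and "p \<in> nodes t"
  shows "cells_of (rect_of (subtree t p)) \<subseteq> cells_of (rect_of t)"
  using assms
proof (induction t arbitrary: h x y Y p)
  case (Bin R l r)
  then show ?case
    using wf_st_children(1)[OF Bin.prems(1)] wf_st_partition_Bin(1)[OF Bin.prems(1)] by fastforce
next
  case (Tri R l r u)
  then show ?case
    using wf_st_children(2)[OF Tri.prems(1)] wf_st_partition_Tri(1)[OF Tri.prems(1)] by fastforce
qed auto

text \<open>Children have disjoint rectangles, so every node whose rectangle contains
  \<open>q\<close> lies on the path found from the root. Climbing to such a node and descending from
  it thus reaches the same leaf.\<close>

lemma route_through:
  assumes "wf_st N h x y Y t" and "p \<in> nodes t" and "q \<in> cells_of (rect_of (subtree t p))"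
  shows "route q t = p @ route q (subtree t p)"
  using assms
proof (induction t arbitrary: h x y Y p)
  case (Bin R l r)
  obtain h1 x1 y1 Y1 h2 x2 y2 Y2 where wf: "wf_st N h1 x1 y1 Y1 l" "wf_st N h2 x2 y2 Y2 r"
    using wf_st_children(1)[OF Bin.prems(1)] by blast
  note sub = subtree_cells[OF wf(1)] subtree_cells[OF wf(2)]
  from Bin.prems(2) consider "p = []" | p' where "p = Left # p'" "p' \<in> nodes l"
    | p' where "p = Right # p'" "p' \<in> nodes r" by auto
  then show ?case
  proof cases
    case 2
    then show ?thesis using Bin.IH(1)[OF wf(1)] Bin.prems(3) sub(1)[of p'] by auto
  next
    case 3
    then show ?thesis
      using Bin.IH(2)[OF wf(2)] Bin.prems(3) sub(2)[of p'] wf_st_partition_Bin(2)[OF Bin.prems(1)] by auto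
  qed simp
next
  case (Tri R l r u)
  obtain h1 x1 y1 Y1 h2 x2 y2 Y2 h3 x3 y3 Y3 where wf: "wf_st N h1 x1 y1 Y1 l" "wf_st N h2 x2 y2 Y2 r"
    "wf_st N h3 x3 y3 Y3 u"
    using wf_st_children(2)[OF Tri.prems(1)] by blast
  note sub = subtree_cells[OF wf(1)] subtree_cells[OF wf(2)] subtree_cells[OF wf(3)]
  note disj = wf_st_partition_Tri(2-4)[OF Tri.prems(1)]
  from Tri.prems(2) consider "p = []" | p' where "p = Left # p'" "p' \<in> nodes l"
    | p' where "p = Right # p'" "p' \<in> nodes r" | p' where "p = Upper # p'" "p' \<in> nodes u" by auto
  then show ?case
  proof cases
    case 2
    then show ?thesis using Tri.IH(1)[OF wf(1)] Tri.prems(3) sub(1)[of p'] by auto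
  next
    case 3
    then show ?thesis using Tri.IH(2)[OF wf(2)] Tri.prems(3) sub(2)[of p'] disj by auto
  next
    case 4
    then show ?thesis using Tri.IH(3)[OF wf(3)] Tri.prems(3) sub(3)[of p'] disj by auto
  qed simp
qed auto

text \<open>The last assumption says that no multiple of \<open>2 ^ e\<close>, counted from \<open>x\<close>, separates the columns;
  this formulation is stable under the shift of \<open>x\<close> in right children.\<close>

lemma route_cong:
  assumes "wf_st N h x y Y t" and "(i, v) \<in> cells_of (rect_of t)" and "(i', v) \<in> cells_of (rect_of t)"
    and "e \<le> h" and "\<And>k. x + k * 2 ^ e \<le> i \<longleftrightarrow> x + k * 2 ^ e \<le> i'"
  shows "take (h - e) (route (i, v) t) = take (h - e) (route (i', v) t)"
  using assms
proof (induction t arbitrary: h x y Y)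
  case (Leaf R pt a)
  then show ?case by simp
next
  case (Bin R l r)
  obtain g where g: "h = Suc g" and c: "wf_st N g x y Y l" "wf_st N g (x + 2 ^ g) y Y r"
    using Bin.prems(1) by auto
  show ?case
  proof (cases "e = h")
    case False
    then have e: "e \<le> g" "h - e = Suc (g - e)" using Bin.prems(4) g by auto
    have pow: "2 ^ g = 2 ^ (g - e) * (2::nat) ^ e" using e by (simp flip: power_add)
    \<comment> \<open>The border between the two halves is at distance \<open>2 ^ g\<close> from
      \<open>x\<close>, itself a multiple of \<open>2 ^ e\<close>, so both columns fall into the
      same half. As the row \<open>v\<close> is shared, an upper child does not separate the points
      either.\<close>
    have side: "x + 2 ^ g \<le> i \<longleftrightarrow> x + 2 ^ g \<le> i'" using Bin.prems(5)[of "2 ^ (g - e)"] pow by simp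
    have shift: "x + 2 ^ g + k * 2 ^ e \<le> i \<longleftrightarrow> x + 2 ^ g + k * 2 ^ e \<le> i'" for k
      using Bin.prems(5)[of "2 ^ (g - e) + k"] pow by (simp add: distrib_right add.assoc)
    have "(i, v) \<in> cells_of (rect_of l) \<longleftrightarrow> (i', v) \<in> cells_of (rect_of l)"
      using Bin.prems(2,3) side unfolding wf_st_cells[OF c(1)] wf_st_cells[OF Bin.prems(1)] by auto
    then show ?thesis
      using Bin.IH(1)[OF c(1) _ _ e(1) Bin.prems(5)] Bin.IH(2)[OF c(2) _ _ e(1) shift] e(2)
        Bin.prems(2,3) wf_st_partition_Bin(1)[OF Bin.prems(1)] by auto
  qed simp
next
  case (Tri R l r u)
  show ?case
  proof (cases "e = h")
    case False
    obtain g where g: "h = Suc g" using Tri.prems(1) by auto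
    then have e: "e \<le> g" "h - e = Suc (g - e)" using Tri.prems(4) False by auto
    have pow: "2 ^ g = 2 ^ (g - e) * (2::nat) ^ e" using e by (simp flip: power_add)
    have side: "x + 2 ^ g \<le> i \<longleftrightarrow> x + 2 ^ g \<le> i'" using Tri.prems(5)[of "2 ^ (g - e)"] pow by simp
    have shift: "x + 2 ^ g + k * 2 ^ e \<le> i \<longleftrightarrow> x + 2 ^ g + k * 2 ^ e \<le> i'" for k
      using Tri.prems(5)[of "2 ^ (g - e) + k"] pow by (simp add: distrib_right add.assoc)
    note part = wf_st_partition_Tri(1)[OF Tri.prems(1)]
    from Tri.prems(1) show ?thesis
    proof (cases rule: wf_st_Tri_cases)
      case (left g' w)
      then have [simp]: "g' = g" using g by simp
      note c = left(4-6)[unfolded \<open>g' = g\<close>]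
      have "(i, v) \<in> cells_of (rect_of l) \<longleftrightarrow> (i', v) \<in> cells_of (rect_of l)"
        "(i, v) \<in> cells_of (rect_of r) \<longleftrightarrow> (i', v) \<in> cells_of (rect_of r)"
        using Tri.prems(2,3) side unfolding wf_st_cells[OF c(1)] wf_st_cells[OF c(2)]
          wf_st_cells[OF Tri.prems(1)] g by auto
      then show ?thesis
        using Tri.IH(1)[OF c(1) _ _ e(1) Tri.prems(5)] Tri.IH(2)[OF c(2) _ _ e(1) shift]
          Tri.IH(3)[OF c(3) _ _ e(1) Tri.prems(5)] e(2) Tri.prems(2,3) part by auto
    next
      case (right g' w)
      then have [simp]: "g' = g" using g by simp
      note c = right(4-6)[unfolded \<open>g' = g\<close>]
      have "(i, v) \<in> cells_of (rect_of l) \<longleftrightarrow> (i', v) \<in> cells_of (rect_of l)"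
        "(i, v) \<in> cells_of (rect_of r) \<longleftrightarrow> (i', v) \<in> cells_of (rect_of r)"
        using Tri.prems(2,3) side unfolding wf_st_cells[OF c(1)] wf_st_cells[OF c(2)]
          wf_st_cells[OF Tri.prems(1)] g by auto
      then show ?thesis
        using Tri.IH(1)[OF c(1) _ _ e(1) Tri.prems(5)] Tri.IH(2)[OF c(2) _ _ e(1) shift]
          Tri.IH(3)[OF c(3) _ _ e(1) shift] e(2) Tri.prems(2,3) part by auto
    qed
  qed simp
qed

text \<open>The case \<open>k = 0\<close> is the arrival at the root, where the climb stops whether
  or not the rectangle contains \<open>q\<close>.\<close>

lemma climb_takes:
  "\<exists>k\<le>length p. climb t q p = map (\<lambda>j. take j p) (rev [k..<Suc (length p)]) \<and>
     (k = 0 \<or> q \<in> cells_of (rect_of (subtree t (take k p))))"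
proof (induction p rule: rev_induct)
  case Nil
  then show ?case by (simp add: climb.simps)
next
  case (snoc d p)
  show ?case
  proof (cases "q \<in> cells_of (rect_of (subtree t (p @ [d])))")
    case True
    then show ?thesis by (intro exI[of _ "Suc (length p)"]) (simp add: climb.simps)
  next
    case False
    obtain k where k: "k \<le> length p" "climb t q p = map (\<lambda>j. take j p) (rev [k..<Suc (length p)])"
      "k = 0 \<or> q \<in> cells_of (rect_of (subtree t (take k p)))"
      using snoc.IH by blast
    have "climb t q (p @ [d]) = (p @ [d]) # climb t q p"
      using False by (subst climb.simps) simp
    also have "climb t q p = map (\<lambda>j. take j (p @ [d])) (rev [k..<Suc (length p)])"
      unfolding k(2) by (rule map_cong) auto
    also have "(p @ [d]) # \<dots> = map (\<lambda>j. take j (p @ [d])) (rev [k..<Suc (length (p @ [d]))])"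
      using k(1) by simp
    finally show ?thesis using k by (intro exI[of _ k]) simp
  qed
qed


section \<open>Memory blocks of search paths\<close>

definition node_addr :: "real \<Rightarrow> nat \<Rightarrow> (nat \<Rightarrow> nat) \<Rightarrow> 'a pds \<Rightarrow> ptr \<Rightarrow> nat" where
  "node_addr \<epsilon> s base D q = base (fst q) + s * node_rank \<epsilon> D q"

definition zone_blocks ::
  "real \<Rightarrow> nat \<Rightarrow> (nat \<Rightarrow> nat) \<Rightarrow> 'a pds \<Rightarrow> nat \<Rightarrow> nat \<Rightarrow> dir list \<Rightarrow> nat set" where
  "zone_blocks \<epsilon> s base D B j p = (\<Union>q\<in>zone p. set (cell_blocks B s (node_addr \<epsilon> s base D (j, q))))"

definition access_blocks ::
  "real \<Rightarrow> nat \<Rightarrow> (nat \<Rightarrow> nat) \<Rightarrow> nat \<Rightarrow> nat \<Rightarrow> 'a pds \<Rightarrow> access list \<Rightarrow> nat list" where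
  "access_blocks \<epsilon> s base tab B D as =
     map (\<lambda>c. c div B) (concat (map (access_cells \<epsilon> s base tab D) as))"

lemma finite_zone_blocks: "finite (zone_blocks \<epsilon> s base D B j p)"
  by (simp add: zone_blocks_def finite_zone)

lemma access_blocks_append:
  "access_blocks \<epsilon> s base tab B D (as @ bs) =
     access_blocks \<epsilon> s base tab B D as @ access_blocks \<epsilon> s base tab B D bs"
  by (simp add: access_blocks_def)

lemma access_blocks_nodes:
  "access_blocks \<epsilon> s base tab B D (map (\<lambda>p. Node (j, p)) ps) =
     concat (map (cell_blocks B s) (map (\<lambda>p. node_addr \<epsilon> s base D (j, p)) ps))"
  by (induction ps) (simp_all add: access_blocks_def cell_blocks_def node_addr_def Let_def)

lemma valid_tree:
  assumes "valid_pds D" and "j < length (trees D)"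
  obtains y Y where "wf_st (V_of D) (lgU D) 1 y Y (trees D ! j)"
  using assms by (auto simp: valid_pds_def)

lemma leaf_ptr_length:
  assumes "valid_pds D" and "leaf_ptr D (j, p)"
  shows "length p = lgU D"
proof -
  from assms(2) have j: "j < length (trees D)" and p: "p \<in> nodes (trees D ! j)"
    "is_leaf (subtree (trees D ! j) p)" by (auto simp: leaf_ptr_def)
  obtain y Y where "wf_st (V_of D) (lgU D) 1 y Y (trees D ! j)" using valid_tree[OF assms(1) j] .
  from wf_st_nodes[OF this p(1)] p(2) show ?thesis by simp
qed

lemma leaf_ptr_route: "j < length (trees D) \<Longrightarrow> leaf_ptr D (j, route q (trees D ! j))"
  by (simp add: leaf_ptr_def route_leaf)

text \<open>In a bottom tree the node \<open>p\<close> itself is counted for \<open>q\<close> but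
  not for \<open>p\<close>, which makes the inequality strict.\<close>

lemma node_rank_less:
  assumes "p \<in> nodes (trees D ! j)" and "veb_pos \<epsilon> (Suc (lgU D)) p < veb_pos \<epsilon> (Suc (lgU D)) q"
  shows "node_rank \<epsilon> D (j, p) < node_rank \<epsilon> D (j, q)"
proof -
  let ?pos = "veb_pos \<epsilon> (Suc (lgU D))"
  have "{r \<in> nodes (trees D ! j). ?pos r < ?pos p} \<subset> {r \<in> nodes (trees D ! j). ?pos r < ?pos q}"
    using assms by auto
  then have "card {r \<in> nodes (trees D ! j). ?pos r < ?pos p} < card {r \<in> nodes (trees D ! j). ?pos r < ?pos q}"
    by (rule psubset_card_mono[rotated]) (simp add: finite_nodes)
  then show ?thesis using assms(2) by (simp add: node_rank_def Let_def)
qed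

lemma node_addr_less:
  assumes "p \<in> nodes (trees D ! j)" and "veb_pos \<epsilon> (Suc (lgU D)) p < veb_pos \<epsilon> (Suc (lgU D)) q"
  shows "node_addr \<epsilon> s base D (j, p) + s \<le> node_addr \<epsilon> s base D (j, q)"
proof -
  have "s * Suc (node_rank \<epsilon> D (j, p)) \<le> s * node_rank \<epsilon> D (j, q)"
    using node_rank_less[OF assms] by (intro mult_le_mono2) simp
  then show ?thesis by (simp add: node_addr_def)
qed

text \<open>Removing the absent nodes from the layout does not move the remaining ones apart.\<close>

lemma node_rank_window:
  assumes "valid_pds D" and "j < length (trees D)"
  shows "\<exists>\<rho>. \<forall>q. a \<le> veb_pos \<epsilon> (Suc (lgU D)) q \<longrightarrow> veb_pos \<epsilon> (Suc (lgU D)) q < a + B \<longrightarrow>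
    node_rank \<epsilon> D (j, q) \<in> {\<rho>..<\<rho> + B}"
proof (cases "Suc j = length (trees D)")
  case True
  then show ?thesis by (intro exI[of _ a]) (simp add: node_rank_def Let_def)
next
  case False
  let ?pos = "veb_pos \<epsilon> (Suc (lgU D))"
  let ?N = "nodes (trees D ! j)"
  have fin: "finite ?N" by (rule finite_nodes)
  obtain y Y where wf: "wf_st (V_of D) (lgU D) 1 y Y (trees D ! j)" using valid_tree[OF assms] .
  have inj: "inj_on ?pos ?N"
    by (rule inj_onI) (use veb_pos_inject wf_st_nodes[OF wf] in \<open>metis less_Suc_eq_le\<close>)
  have "node_rank \<epsilon> D (j, q) \<in> {card {r \<in> ?N. ?pos r < a}..<card {r \<in> ?N. ?pos r < a} + B}"
    if q: "a \<le> ?pos q" "?pos q < a + B" for q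
  proof -
    have "node_rank \<epsilon> D (j, q) = card {r \<in> ?N. ?pos r < ?pos q}"
      using False by (simp add: node_rank_def Let_def)
    also have "{r \<in> ?N. ?pos r < ?pos q} = {r \<in> ?N. ?pos r < a} \<union> {r \<in> ?N. a \<le> ?pos r \<and> ?pos r < ?pos q}"
      using q by auto
    also have "card \<dots> = card {r \<in> ?N. ?pos r < a} + card {r \<in> ?N. a \<le> ?pos r \<and> ?pos r < ?pos q}"
      using fin by (intro card_Un_disjoint) auto
    finally have eq: "node_rank \<epsilon> D (j, q) =
      card {r \<in> ?N. ?pos r < a} + card {r \<in> ?N. a \<le> ?pos r \<and> ?pos r < ?pos q}" .
    \<comment> \<open>Present nodes have distinct positions, so fewer than \<open>B\<close> of them
      lie in the window before \<open>q\<close>. The node \<open>q\<close> itself may be absent,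
      hence the argument applies to the whole zone of a path.\<close>
    have "card {r \<in> ?N. a \<le> ?pos r \<and> ?pos r < ?pos q} \<le> card {a..<?pos q}"
      by (rule card_inj_on_le[of ?pos]) (auto intro: inj_on_subset[OF inj])
    then show ?thesis using eq q by simp
  qed
  then show ?thesis by blast
qed

text \<open>The window consists of \<open>s * B\<close> consecutive cells, which at any offset touch
  at most \<open>s + 1\<close> blocks.\<close>

lemma window_blocks:
  assumes "0 < B"
  shows "card (\<Union>x\<in>{\<rho>..<\<rho> + B}. set (cell_blocks B s (b + s * x))) \<le> s + 1"
proof -
  have "(\<Union>x\<in>{\<rho>..<\<rho> + B}. set (cell_blocks B s (b + s * x))) \<subseteq> {(b + s * \<rho>) div B..(b + s * \<rho>) div B + s}"
  proof
    fix d assume "d \<in> (\<Union>x\<in>{\<rho>..<\<rho> + B}. set (cell_blocks B s (b + s * x)))"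
    then obtain x c where x: "\<rho> \<le> x" "x < \<rho> + B" and c: "b + s * x \<le> c" "c < b + s * x + s" "d = c div B"
      by (auto simp: cell_blocks_def)
    have "s * Suc x \<le> s * (\<rho> + B)" using x by (intro mult_le_mono2) simp
    then have "c \<le> b + s * \<rho> + s * B" using c by (simp add: distrib_left)
    then have "d \<le> (b + s * \<rho> + s * B) div B" unfolding c(3) by (rule div_le_mono)
    also have "\<dots> = (b + s * \<rho>) div B + s" using assms by simp
    finally have "d \<le> (b + s * \<rho>) div B + s" .
    moreover have "b + s * \<rho> \<le> c" using c(1) mult_le_mono2[OF x(1), of s] by linarith
    then have "(b + s * \<rho>) div B \<le> d" unfolding c(3) by (rule div_le_mono)
    ultimately show "d \<in> {(b + s * \<rho>) div B..(b + s * \<rho>) div B + s}" by simp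
  qed
  then have "card (\<Union>x\<in>{\<rho>..<\<rho> + B}. set (cell_blocks B s (b + s * x))) \<le> card {(b + s * \<rho>) div B..(b + s * \<rho>) div B + s}"
    by (rule card_mono[rotated]) simp
  then show ?thesis by simp
qed

text \<open>From \<open>B < 3 ^ Suc m \<le> 3 ^ (2 * m) \<le> 2 ^ (4 * m)\<close> follows
  \<open>log 2 B \<le> 4 * m\<close>, and \<open>L\<close> is \<open>log 2 B\<close> times the
  logarithm of \<open>2 ^ L\<close> to base \<open>B\<close>. This turns the number of levels
  divided by \<open>m\<close> into \<open>1 + log_B U\<close>.\<close>

lemma levels_per_part:
  assumes "2 \<le> B" and "1 \<le> m" and "B < ternary_size (Suc m)"
  shows "real (Suc L) \<le> 4 * (1 + log (real B) (2 ^ L)) * real m"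
proof -
  have "3 ^ Suc m \<le> (2::nat) ^ (4 * m)"
  proof -
    have "(3::nat) ^ Suc m \<le> 3 ^ (2 * m)" using assms(2) by (intro power_increasing) auto
    also have "\<dots> \<le> 4 ^ (2 * m)" by (rule power_mono) auto
    also have "\<dots> = 2 ^ (4 * m)" by (simp add: power_mult[of 2 2 "2 * m", simplified])
    finally show ?thesis .
  qed
  then have "B \<le> 2 ^ (4 * m)" using assms(3) ternary_size_closed[of "Suc m"] by linarith
  then have "real B \<le> 2 ^ (4 * m)" by (metis of_nat_le_iff of_nat_numeral of_nat_power)
  then have "log 2 (real B) \<le> log 2 (2 ^ (4 * m))" using assms(1) by (intro log_mono) auto
  then have lg: "log 2 (real B) \<le> 4 * real m" by (simp add: log_nat_power)
  have pos: "1 \<le> log 2 (real B)" using assms(1) by (simp add: le_log_iff)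
  have eq: "log (real B) (2 ^ L) = real L / log 2 (real B)"
    using assms(1) by (simp add: log_def ln_realpow)
  have "real L = log (real B) (2 ^ L) * log 2 (real B)" using pos eq by simp
  also have "\<dots> \<le> log (real B) (2 ^ L) * (4 * real m)"
    using lg pos eq by (intro mult_left_mono) auto
  finally show ?thesis using assms(2) by (simp add: algebra_simps)
qed

text \<open>The factor 4 of \<open>veb_cover\<close> times the 4 of \<open>levels_per_part\<close>
  times the \<open>s + 1\<close> blocks of a window, divided by the guaranteed share of
  levels.\<close>

definition part_const :: "real \<Rightarrow> nat \<Rightarrow> real" where
  "part_const \<epsilon> s = 16 * (real s + 1) / split_ratio \<epsilon>"

lemma part_const_ge:
  assumes "0 < \<epsilon>" and "\<epsilon> < 1"
  shows "1 \<le> part_const \<epsilon> s"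
  using split_ratio_bounds[OF assms] by (simp add: part_const_def le_divide_eq)

lemma part_blocks:
  assumes "0 < \<epsilon>" and "\<epsilon> < 1" and "valid_pds D" and "j < length (trees D)"
    and "2 \<le> B" and "1 \<le> m" and "ternary_size m \<le> B" and "B < ternary_size (Suc m)"
    and "length p = lgU D"
  shows "\<exists>Z. finite Z \<and> real (card Z) \<le> part_const \<epsilon> s * (1 + log (real B) (real (U_of D))) \<and>
    (\<forall>p'. length p' = lgU D \<longrightarrow>
       take (Suc (lgU D) - leaf_levels \<epsilon> m (Suc (lgU D))) p' =
       take (Suc (lgU D) - leaf_levels \<epsilon> m (Suc (lgU D))) p \<longrightarrow>
       zone_blocks \<epsilon> s base D B j p' \<subseteq> Z)"
proof -
  define n where "n = Suc (lgU D)"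
  define k where "k = n - leaf_levels \<epsilon> m n"
  define l where "l = 1 + log (real B) (real (U_of D))"
  let ?d = "split_ratio \<epsilon>"
  have d: "0 < ?d" "?d \<le> 1" using split_ratio_bounds[OF assms(1,2)] by auto
  have np: "1 \<le> n" "length p = n - 1" using assms(9) by (simp_all add: n_def)
  obtain I where I: "finite I"
    and cI: "(real (card I) + 3) * (?d * real m) \<le> 4 * max (real n) (?d * real m)"
    and cov: "\<forall>p' q. length p' = n - 1 \<longrightarrow> take k p' = take k p \<longrightarrow> q \<in> zone p' \<longrightarrow>
      (\<exists>a\<in>I. a \<le> veb_pos \<epsilon> n q \<and> veb_pos \<epsilon> n q < a + B)"
    using veb_cover[OF assms(1,2,6,7) np, folded k_def] by (elim exE conjE)
  have "\<forall>a. \<exists>\<rho>. \<forall>q. a \<le> veb_pos \<epsilon> n q \<longrightarrow> veb_pos \<epsilon> n q < a + B \<longrightarrow> node_rank \<epsilon> D (j, q) \<in> {\<rho>..<\<rho> + B}"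
    unfolding n_def using node_rank_window[OF assms(3,4)] by blast
  then obtain \<rho> where \<rho>: "\<And>a q. a \<le> veb_pos \<epsilon> n q \<Longrightarrow> veb_pos \<epsilon> n q < a + B \<Longrightarrow>
      node_rank \<epsilon> D (j, q) \<in> {\<rho> a..<\<rho> a + B}"
    by metis
  define Zf where "Zf a = (\<Union>x\<in>{\<rho> a..<\<rho> a + B}. set (cell_blocks B s (base j + s * x)))" for a
  define Z where "Z = (\<Union>a\<in>I. Zf a)"
  have finZ: "finite Z" using I by (simp add: Z_def Zf_def)
  have "card Z \<le> (\<Sum>a\<in>I. card (Zf a))" unfolding Z_def by (rule card_UN_le[OF I])
  also have "\<dots> \<le> (\<Sum>a\<in>I. s + 1)"
    unfolding Zf_def by (rule sum_mono, rule window_blocks) (use assms(5) in simp)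
  also have "\<dots> = card I * (s + 1)" by simp
  finally have "real (card Z) \<le> real (card I * (s + 1))" by (simp only: of_nat_le_iff)
  then have cZ: "real (card Z) \<le> real (card I) * (real s + 1)" by (simp add: distrib_left)
  have l: "1 \<le> l" using assms(5) by (simp add: l_def U_of_def log_nat_power)
  have nm: "real n \<le> 4 * l * real m"
    using levels_per_part[OF assms(5,6,8), of "lgU D"] by (simp add: n_def l_def U_of_def)
  have "?d * real m \<le> 1 * real m" using d by (intro mult_right_mono) auto
  also have "\<dots> \<le> 4 * l * real m" using l by (intro mult_right_mono) auto
  finally have "max (real n) (?d * real m) \<le> 4 * l * real m" using nm by simp
  then have "(real (card I) + 3) * (?d * real m) \<le> 16 * l * real m" using cI by linarith
  then have "((real (card I) + 3) * ?d) * real m \<le> (16 * l) * real m" by (simp add: mult.assoc)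
  then have "(real (card I) + 3) * ?d \<le> 16 * l" using assms(6) by simp
  then have "real (card I) * ?d \<le> 16 * l" using d by (simp add: distrib_right)
  then have "real (card I) \<le> 16 * l / ?d" using d by (simp add: le_divide_eq)
  then have "real (card I) * (real s + 1) \<le> 16 * l / ?d * (real s + 1)" by (rule mult_right_mono) simp
  with cZ have "real (card Z) \<le> part_const \<epsilon> s * l" by (simp add: part_const_def mult_ac)
  moreover have "zone_blocks \<epsilon> s base D B j p' \<subseteq> Z" if "length p' = lgU D" "take k p' = take k p" for p'
  proof
    fix b assume "b \<in> zone_blocks \<epsilon> s base D B j p'"
    then obtain q where q: "q \<in> zone p'" "b \<in> set (cell_blocks B s (node_addr \<epsilon> s base D (j, q)))"
      by (auto simp: zone_blocks_def)
    have "length p' = n - 1" using that(1) by (simp add: n_def)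
    with cov that(2) q(1) obtain a where a: "a \<in> I" "a \<le> veb_pos \<epsilon> n q" "veb_pos \<epsilon> n q < a + B"
      by blast
    have "b \<in> Zf a"
      unfolding Zf_def using q(2) by (intro UN_I[OF \<rho>[OF a(2,3)]]) (simp add: node_addr_def)
    then show "b \<in> Z" using a(1) unfolding Z_def by blast
  qed
  ultimately show ?thesis using finZ unfolding l_def k_def n_def by blast
qed

text \<open>The division by \<open>log 2 3\<close> converts the branching 3 of the layout into the
  doubling of widths. The factor \<open>4 = 2 ^ 2\<close> makes up for two levels: the one lost in
  \<open>leaf_levels_ge\<close>, and the height of a root being one less than its number of
  levels.\<close>

lemma part_width:
  assumes "0 < \<epsilon>" and "\<epsilon> < 1" and "1 \<le> m" and "2 \<le> B" and "B < ternary_size (Suc m)" and "m < n"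
  shows "real B powr ((1 - \<epsilon>) / log 2 3) \<le> 4 * 2 ^ (leaf_levels \<epsilon> m n - 1)"
proof -
  let ?g = "(1 - \<epsilon>) / log 2 3"
  define h where "h = leaf_levels \<epsilon> m n"
  have h: "1 \<le> h" unfolding h_def using assms by (intro leaf_levels_pos) simp
  have lg3: "0 < log 2 (3::real)" by simp
  have "B \<le> 3 ^ Suc m" using assms(5) ternary_size_closed[of "Suc m"] by linarith
  then have "real B \<le> 3 ^ Suc m" by (metis of_nat_le_iff of_nat_numeral of_nat_power)
  also have "\<dots> = 3 powr (real m + 1)" using powr_realpow[of 3 "Suc m"] by (simp add: add.commute)
  also have "\<dots> = (2 powr log 2 3) powr (real m + 1)" by simp
  also have "\<dots> = 2 powr (log 2 3 * (real m + 1))" by (simp only: powr_powr)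
  finally have "real B powr ?g \<le> (2 powr (log 2 3 * (real m + 1))) powr ?g"
    using assms lg3 by (intro powr_mono2) auto
  also have "\<dots> = 2 powr ((1 - \<epsilon>) * (real m + 1))" 
    using less_imp_neq[OF lg3] by (simp add: powr_powr mult.commute)
  also have "\<dots> \<le> 2 powr (real h + 1)"
    using leaf_levels_ge[OF assms(1-3,6)] by (intro powr_mono) (auto simp: h_def)
  also have "\<dots> = 2 ^ Suc h" using powr_realpow[of 2 "Suc h"] by (simp add: add.commute)
  also have "\<dots> = 4 * 2 ^ (h - 1)" using h by (cases h) auto
  finally show ?thesis by (simp add: h_def)
qed

lemma column_blocks:
  fixes \<epsilon> :: real and b :: int
  assumes "0 < \<epsilon>" and "\<epsilon> < 1" and "valid_pds D" and "version_tree D v j" and "2 \<le> B"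
  shows "\<exists>Z. finite Z \<and> real (card Z) \<le> 5 * (part_const \<epsilon> s * (1 + log (real B) (real (U_of D)))) \<and>
    (\<forall>i. 1 \<le> i \<longrightarrow> i \<le> U_of D \<longrightarrow> array_block (real B powr ((1 - \<epsilon>) / log 2 3)) i = b \<longrightarrow>
       zone_blocks \<epsilon> s base D B j (route (i, v) (trees D ! j)) \<subseteq> Z)"
proof -
  have j: "j < length (trees D)"
    and cover: "\<And>i. 1 \<le> i \<Longrightarrow> i \<le> U_of D \<Longrightarrow> (i, v) \<in> cells_of (rect_of (trees D ! j))"
    using assms(4) by (auto simp: version_tree_def)
  define \<beta> where "\<beta> = real B powr ((1 - \<epsilon>) / log 2 3)"
  define c where "c = part_const \<epsilon> s * (1 + log (real B) (real (U_of D)))"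
  have \<beta>: "0 < \<beta>" using assms(5) by (simp add: \<beta>_def)
  obtain m where m: "1 \<le> m" "ternary_size m \<le> B" "B < ternary_size (Suc m)"
    using ternary_levels[of B] assms(5) by auto
  define n where "n = Suc (lgU D)"
  define h where "h = leaf_levels \<epsilon> m n"
  have h: "1 \<le> h" "h \<le> n" unfolding h_def using leaf_levels_pos leaf_levels_le by (auto simp: n_def)
  define w where "w = (2::nat) ^ (h - 1)"
  have w: "0 < w" by (simp add: w_def)
  define C where "C = {i. 1 \<le> i \<and> i \<le> U_of D \<and> array_block \<beta> i = b}"
  \<comment> \<open>The parts with leaves stand over aligned groups of \<open>w\<close> columns;
    \<open>K\<close> numbers the groups met by array block \<open>b\<close>. Columns within a
    distance of \<open>4 * w\<close> meet at most 5 groups.\<close>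
  define K where "K = (\<lambda>i. (i - 1) div w) ` C"
  let ?t = "trees D ! j"
  let ?r = "\<lambda>i. route (i, v) ?t"
  have finC: "finite C" by (rule finite_subset[of _ "{..U_of D}"]) (auto simp: C_def)
  have K5: "card K \<le> 5"
  proof (cases "C = {}")
    case False
    define i0 where "i0 = Min C"
    have i0: "i0 \<in> C" "\<And>i. i \<in> C \<Longrightarrow> i0 \<le> i" using False finC by (auto simp: i0_def)
    have "K \<subseteq> {(i0 - 1) div w..(i0 - 1) div w + 4}"
    proof
      fix \<kappa> assume "\<kappa> \<in> K"
      then obtain i where i: "i \<in> C" "\<kappa> = (i - 1) div w" by (auto simp: K_def)
      have le: "i0 \<le> i" using i0 i by simp
      have "i - 1 \<le> i0 - 1 + 4 * w"
      proof (cases "n \<le> m")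
        \<comment> \<open>Here the whole tree is one part, and its width is \<open>U\<close>
          itself.\<close>
        case True
        then have "h = n" by (simp add: h_def leaf_levels.simps)
        then have "U_of D = w" by (simp add: w_def n_def U_of_def)
        then show ?thesis using i i0 by (auto simp: C_def)
      next
        case False
        have "\<lfloor>(real i - 1) / \<beta>\<rfloor> = \<lfloor>(real i0 - 1) / \<beta>\<rfloor>" using i i0 by (auto simp: C_def array_block_def)
        then have "(real i - 1) / \<beta> < (real i0 - 1) / \<beta> + 1" by linarith
        also have "\<dots> = (real i0 - 1 + \<beta>) / \<beta>" using \<beta> by (simp add: field_simps)
        finally have "real i - 1 < real i0 - 1 + \<beta>" using \<beta> by (simp add: divide_less_cancel)
        also have "\<beta> \<le> 4 * real w"
          using part_width[OF assms(1,2) m(1) assms(5) m(3), of n] False by (simp add: \<beta>_def w_def h_def)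
        finally have "real i < real (i0 + 4 * w)" by simp
        then have "i < i0 + 4 * w" by (simp only: of_nat_less_iff)
        moreover have "1 \<le> i0" using i0 by (simp add: C_def)
        ultimately show ?thesis by linarith
      qed
      then have "\<kappa> \<le> (i0 - 1 + 4 * w) div w" unfolding i(2) by (rule div_le_mono)
      also have "\<dots> = (i0 - 1) div w + 4" using w by simp
      finally have "\<kappa> \<le> (i0 - 1) div w + 4" .
      moreover have "(i0 - 1) div w \<le> \<kappa>" unfolding i(2) using le by (intro div_le_mono) simp
      ultimately show "\<kappa> \<in> {(i0 - 1) div w..(i0 - 1) div w + 4}" by simp
    qed
    then have "card K \<le> card {(i0 - 1) div w..(i0 - 1) div w + 4}" by (rule card_mono[rotated]) simp
    then show ?thesis by simp
  qed (simp add: K_def)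
  obtain y Y where wf: "wf_st (V_of D) (lgU D) 1 y Y ?t" using valid_tree[OF assms(3) j] .
  have len: "length (?r i) = lgU D" for i using wf_st_nodes[OF wf] route_leaf by blast
  have same: "take (n - h) (?r i) = take (n - h) (?r i')"
    if "i \<in> C" "i' \<in> C" "(i - 1) div w = (i' - 1) div w" for i i'
  proof -
    have "1 + k * w \<le> i \<longleftrightarrow> 1 + k * w \<le> i'" for k
    proof -
      have "1 + k * w \<le> x \<longleftrightarrow> k \<le> (x - 1) div w" if "1 \<le> x" for x
        using that w by (auto simp: less_eq_div_iff_mult_less_eq)
      then show ?thesis using that by (simp add: C_def)
    qed
    \<comment> \<open>The root of a part with \<open>h\<close> levels has height
      \<open>h - 1\<close>, and the tree has \<open>lgU D + 1\<close> levels.\<close>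
    moreover have "n - h = lgU D - (h - 1)" using h by (simp add: n_def)
    ultimately show ?thesis
      using route_cong[OF wf, of i v i' "h - 1"] cover that h by (simp add: C_def w_def n_def)
  qed
  have "\<forall>\<kappa>\<in>K. \<exists>Z. finite Z \<and> real (card Z) \<le> c \<and>
    (\<forall>i\<in>C. (i - 1) div w = \<kappa> \<longrightarrow> zone_blocks \<epsilon> s base D B j (?r i) \<subseteq> Z)"
  proof
    fix \<kappa> assume "\<kappa> \<in> K"
    then obtain i0 where i0: "i0 \<in> C" "\<kappa> = (i0 - 1) div w" by (auto simp: K_def)
    obtain Z where Z: "finite Z" "real (card Z) \<le> c"
      "\<forall>p'. length p' = lgU D \<longrightarrow> take (n - h) p' = take (n - h) (?r i0) \<longrightarrow>
        zone_blocks \<epsilon> s base D B j p' \<subseteq> Z"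
      using part_blocks[OF assms(1-3) j assms(5) m len, of s i0 base, folded n_def, folded h_def c_def]
      by (elim exE conjE)
    have "zone_blocks \<epsilon> s base D B j (?r i) \<subseteq> Z" if "i \<in> C" "(i - 1) div w = \<kappa>" for i
      using Z(3) len same[OF that(1) i0(1)] that(2) i0(2) by metis
    then show "\<exists>Z. finite Z \<and> real (card Z) \<le> c \<and>
      (\<forall>i\<in>C. (i - 1) div w = \<kappa> \<longrightarrow> zone_blocks \<epsilon> s base D B j (?r i) \<subseteq> Z)"
      using Z(1,2) by blast
  qed
  then obtain Zf where Zf: "\<And>\<kappa>. \<kappa> \<in> K \<Longrightarrow> finite (Zf \<kappa>) \<and> real (card (Zf \<kappa>)) \<le> c \<and>
    (\<forall>i\<in>C. (i - 1) div w = \<kappa> \<longrightarrow> zone_blocks \<epsilon> s base D B j (?r i) \<subseteq> Zf \<kappa>)"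
    by metis
  define Z where "Z = (\<Union>\<kappa>\<in>K. Zf \<kappa>)"
  have finK: "finite K" using finC by (simp add: K_def)
  have "real (card Z) \<le> real (\<Sum>\<kappa>\<in>K. card (Zf \<kappa>))"
    unfolding Z_def using card_UN_le[OF finK] of_nat_le_iff by blast
  also have "\<dots> = (\<Sum>\<kappa>\<in>K. real (card (Zf \<kappa>)))" by simp
  also have "\<dots> \<le> (\<Sum>\<kappa>\<in>K. c)" using Zf by (intro sum_mono) auto
  also have "\<dots> = real (card K) * c" by simp
  also have "\<dots> \<le> 5 * c"
  proof (rule mult_right_mono)
    show "0 \<le> c"
      using part_const_ge[OF assms(1,2), of s] assms(5) by (simp add: c_def U_of_def log_nat_power)
  qed (use K5 in simp)
  finally have "real (card Z) \<le> 5 * c" .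
  moreover have "finite Z" using finK Zf by (simp add: Z_def)
  moreover have "zone_blocks \<epsilon> s base D B j (?r i) \<subseteq> Z"
    if "1 \<le> i" "i \<le> U_of D" "array_block \<beta> i = b" for i
  proof -
    have "i \<in> C" using that by (simp add: C_def)
    moreover from this have "(i - 1) div w \<in> K" by (simp add: K_def)
    ultimately show ?thesis using Zf unfolding Z_def by blast
  qed
  ultimately show ?thesis unfolding \<beta>_def c_def by blast
qed

text \<open>In the last bound, 3 is the price of climbing in descending order, 1 pays for the table
  of roots, and 2 for the ascending descent together with the visit of the new root before
  it.\<close>

lemma read_step:
  fixes \<epsilon> :: real
  assumes "valid_pds D" and "leaf_ptr D (j0, p0)" and "version_tree D v j"
    and "1 \<le> i" and "i \<le> U_of D" and "0 < B" and "0 < s"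
  shows "\<exists>x as. persistent_read D (j0, p0) (v, i) = (x, (j, route (i, v) (trees D ! j)), as) \<and>
    set (access_blocks \<epsilon> s base tab B D as) \<subseteq>
      zone_blocks \<epsilon> s base D B j0 p0 \<union> zone_blocks \<epsilon> s base D B j (route (i, v) (trees D ! j)) \<union>
      (if j0 = j then {} else {(tab + j) div B}) \<and>
    access_blocks \<epsilon> s base tab B D as \<noteq> [] \<and>
    (\<forall>z. changes z (access_blocks \<epsilon> s base tab B D as) \<le>
      3 * card (zone_blocks \<epsilon> s base D B j0 p0) + 1 +
      2 * card (zone_blocks \<epsilon> s base D B j (route (i, v) (trees D ! j))))"
proof -
  have j: "j < length (trees D)"
    and cover: "(i, v) \<in> cells_of (rect_of (trees D ! j))"
    and unique: "\<And>k. k < length (trees D) \<Longrightarrow> (i, v) \<in> cells_of (rect_of (trees D ! k)) \<Longrightarrow> k = j"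
    using assms(3-5) by (auto simp: version_tree_def)
  let ?q = "(i, v)"
  let ?tp = "trees D ! j0" and ?t = "trees D ! j"
  let ?r = "route ?q ?t"
  let ?AB = "access_blocks \<epsilon> s base tab B D"
  let ?addr = "\<lambda>j p. node_addr \<epsilon> s base D (j, p)"
  let ?Zp = "zone_blocks \<epsilon> s base D B j0 p0" and ?Z = "zone_blocks \<epsilon> s base D B j ?r"
  let ?n = "Suc (lgU D)"
  have j0: "j0 < length (trees D)" and p0: "p0 \<in> nodes ?tp" using assms(2) by (auto simp: leaf_ptr_def)
  have len0: "length p0 = lgU D" using leaf_ptr_length[OF assms(1,2)] .
  obtain y0 Y0 where wf0: "wf_st (V_of D) (lgU D) 1 y0 Y0 ?tp" using valid_tree[OF assms(1) j0] .
  obtain y Y where wf: "wf_st (V_of D) (lgU D) 1 y Y ?t" using valid_tree[OF assms(1) j] .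
  obtain k where k: "k \<le> length p0"
    "climb ?tp ?q p0 = map (\<lambda>j. take j p0) (rev [k..<Suc (length p0)])"
    "k = 0 \<or> ?q \<in> cells_of (rect_of (subtree ?tp (take k p0)))"
    using climb_takes by blast
  define ups where "ups = climb ?tp ?q p0"
  have last_ups: "last ups = take k p0" using k(1) by (simp add: ups_def k(2) last_map last_rev del: upt_Suc)
  have ups_ne: "ups \<noteq> []" using k(1) by (simp add: ups_def k(2) del: upt_Suc)
  have ups_set: "set ups \<subseteq> (\<lambda>k. take k p0) ` {..length p0}"
    using k(1) by (auto simp: ups_def k(2) simp del: upt_Suc)
  have ups_blocks: "set (?AB (map (\<lambda>p. Node (j0, p)) ups)) \<subseteq> ?Zp"
    using ups_set zone_take by (fastforce simp: access_blocks_nodes zone_blocks_def)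
  have ups_changes: "changes z (?AB (map (\<lambda>p. Node (j0, p)) ups)) \<le> 3 * card ?Zp" for z
  proof -
    have "?addr j0 (take a p0) + s \<le> ?addr j0 (take b p0)" if "a < b" "b \<le> length p0" for a b
    proof (rule node_addr_less)
      have "veb_pos \<epsilon> ?n (take a p0) < veb_pos \<epsilon> ?n (take a p0 @ take (b - a) (drop a p0))"
        by (rule veb_pos_extend) (use that len0 in auto)
      also have "take a p0 @ take (b - a) (drop a p0) = take b p0"
        using that by (metis le_add_diff_inverse less_imp_le take_add)
      finally show "veb_pos \<epsilon> ?n (take a p0) < veb_pos \<epsilon> ?n (take b p0)" .
    qed (rule nodes_take[OF p0])
    then have "sorted_wrt (\<lambda>a b. b + s \<le> a) (map (?addr j0) ups)"
      unfolding ups_def k(2) map_map sorted_wrt_map sorted_wrt_rev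
      by (intro sorted_wrt_mono_rel[OF _ sorted_wrt_upt]) (auto simp del: upt_Suc)
    then have "changes z (?AB (map (\<lambda>p. Node (j0, p)) ups)) \<le>
      3 * card (\<Union>a\<in>set (map (?addr j0) ups). set (cell_blocks B s a))"
      unfolding access_blocks_nodes by (rule changes_descending[OF assms(6,7)])
    also have "\<dots> \<le> 3 * card ?Zp"
      using ups_blocks unfolding access_blocks_nodes by (intro mult_le_mono2 card_mono finite_zone_blocks) simp
    finally show ?thesis .
  qed
  define found where "found \<longleftrightarrow> ?q \<in> cells_of (rect_of (subtree ?tp (last ups)))"
  \<comment> \<open>In the tree of the version already the root contains the point, so the climb
    succeeds at the latest there; in any other tree no node contains it.\<close>
  have found: "found \<longleftrightarrow> j0 = j"
  proof
    assume found
    then have "?q \<in> cells_of (rect_of ?tp)"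
      unfolding found_def last_ups using subtree_cells[OF wf0 nodes_take[OF p0]] by blast
    then show "j0 = j" using unique[OF j0] by simp
  next
    assume "j0 = j"
    then show found
      unfolding found_def last_ups using k(3) cover by (cases "k = 0") auto
  qed
  define j' where "j' = (if found then j0
    else LEAST k. k < length (trees D) \<and> ?q \<in> cells_of (rect_of (trees D ! k)))"
  have "(LEAST k. k < length (trees D) \<and> ?q \<in> cells_of (rect_of (trees D ! k))) = j"
  proof (rule Least_equality)
    show "j < length (trees D) \<and> ?q \<in> cells_of (rect_of ?t)" using j cover by blast
    show "j \<le> k" if "k < length (trees D) \<and> ?q \<in> cells_of (rect_of (trees D ! k))" for k
      using that unique by blast
  qed
  then have j': "j' = j" unfolding j'_def using found by simp
  define p' where "p' = (if found then last ups else [])"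
  have p'_nodes: "p' \<in> nodes ?t"
    using nodes_take[OF p0] found by (auto simp: p'_def last_ups Nil_in_nodes)
  have p'_cells: "?q \<in> cells_of (rect_of (subtree ?t p'))"
    using cover found by (auto simp: p'_def found_def)
  define ds where "ds = descend ?q (subtree ?t p')"
  define downs where "downs = map ((@) p') ds"
  have r: "?r = p' @ route ?q (subtree ?t p')" by (rule route_through[OF wf p'_nodes p'_cells])
  have "last (p' # downs) = p' @ last ([] # ds)"
    by (cases ds) (auto simp: downs_def last_map)
  then have leaf: "last (p' # downs) = ?r" unfolding r ds_def last_descend .
  have downs_zone: "set downs \<subseteq> zone ?r" 
    unfolding r downs_def ds_def using descend_zone zone_append by fastforce
  have downs_nodes: "set downs \<subseteq> nodes ?t"
    unfolding downs_def ds_def using descend_nodes nodes_append[OF p'_nodes] by fastforce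
  have downs_blocks: "set (?AB (map (\<lambda>p. Node (j, p)) downs)) \<subseteq> ?Z"
    using downs_zone by (fastforce simp: access_blocks_nodes zone_blocks_def)
  have downs_changes: "changes z (?AB (map (\<lambda>p. Node (j, p)) downs)) \<le> card ?Z" for z
  proof -
    have "sorted_wrt precedes downs"
      unfolding downs_def sorted_wrt_map
      by (rule sorted_wrt_mono_rel[OF _ sorted_descend[of ?q "subtree ?t p'", folded ds_def]])
        (rule precedes_append)
    then have "sorted_wrt (\<lambda>a b. ?addr j a + s \<le> ?addr j b) downs"
    proof (rule sorted_wrt_mono_rel[rotated])
      fix a b assume ab: "a \<in> set downs" "b \<in> set downs" "precedes a b"
      then have "length b < ?n" using downs_nodes wf_st_nodes[OF wf] by (meson less_Suc_eq_le subsetD)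
      then show "?addr j a + s \<le> ?addr j b"
        using ab downs_nodes by (intro node_addr_less veb_pos_precedes) auto
    qed
    then have "sorted_wrt (\<lambda>a b. a + s \<le> b) (map (?addr j) downs)" by (simp add: sorted_wrt_map)
    then have "changes z (?AB (map (\<lambda>p. Node (j, p)) downs)) \<le>
      card (\<Union>a\<in>set (map (?addr j) downs). set (cell_blocks B s a))"
      unfolding access_blocks_nodes by (rule changes_ascending)
    also have "\<dots> \<le> card ?Z"
      using downs_blocks unfolding access_blocks_nodes by (intro card_mono finite_zone_blocks) simp
    finally show ?thesis .
  qed
  define mid where "mid = (if found then [] else [Root_entry j, Node (j, [])])"
  have mid_eq: "?AB mid = (if found then [] else (tab + j) div B # cell_blocks B s (?addr j []))"
    by (simp add: mid_def access_blocks_def cell_blocks_def node_addr_def Let_def)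
  have root_blocks: "set (cell_blocks B s (?addr j [])) \<subseteq> ?Z"
    using zone_take[of 0 ?r] by (auto simp: zone_blocks_def)
  have mid_blocks: "set (?AB mid) \<subseteq> ?Z \<union> (if j0 = j then {} else {(tab + j) div B})"
    using root_blocks found by (auto simp: mid_eq)
  have mid_changes: "changes z (?AB mid) \<le> 1 + card ?Z" for z
  proof -
    have le: "changes z' (cell_blocks B s (?addr j [])) \<le> card ?Z" for z'
      using changes_sorted_le[OF sorted_cell_blocks] card_mono[OF finite_zone_blocks root_blocks] order_trans
      by blast
    show ?thesis by (simp add: mid_eq le le_SucI)
  qed
  define as where "as = map (\<lambda>p. Node (j0, p)) ups @ mid @ map (\<lambda>p. Node (j, p)) downs"
  have "persistent_read D (j0, p0) (v, i) = (leaf_value v (subtree ?t ?r), (j, ?r), as)"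
    unfolding persistent_read_def Let_def split
    using leaf unfolding as_def mid_def downs_def ds_def p'_def ups_def[symmetric] 
      found_def[symmetric] j'_def[symmetric] j'
    by simp
  moreover have "set (?AB as) \<subseteq> ?Zp \<union> ?Z \<union> (if j0 = j then {} else {(tab + j) div B})"
    using ups_blocks mid_blocks downs_blocks unfolding as_def access_blocks_append by auto
  moreover have "?AB as \<noteq> []"
  proof -
    have "?AB (map (\<lambda>p. Node (j0, p)) ups) \<noteq> []"
      unfolding access_blocks_nodes using ups_ne cell_blocks_not_Nil[OF assms(7)] by (cases ups) auto
    then show ?thesis by (simp add: as_def access_blocks_append)
  qed
  moreover have "changes z (?AB as) \<le> 3 * card ?Zp + 1 + 2 * card ?Z" for z
    unfolding as_def access_blocks_append changes_append
    by (rule order_trans[OF add_mono[OF ups_changes add_mono[OF mid_changes downs_changes]]]) simp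
  ultimately show ?thesis by blast
qed


section \<open>Sequences of reads\<close>

text \<open>Old and new leaf have zones of at most \<open>u\<close> blocks each, so a read costs at
  most \<open>3 * u + 1 + 2 * u\<close>, whichever block is resident before it.\<close>

lemma reads_changes:
  fixes \<epsilon> :: real
  assumes "valid_pds D" and "version_tree D v j"
    and "0 < B" and "0 < s"
    and zone: "\<And>j p. leaf_ptr D (j, p) \<Longrightarrow> card (zone_blocks \<epsilon> s base D B j p) \<le> u"
    and "leaf_ptr D p" and "\<forall>(w, i)\<in>set X. w = v \<and> 1 \<le> i \<and> i \<le> U_of D"
  shows "changes z (access_blocks \<epsilon> s base tab B D (read_accesses D p X)) \<le> (5 * u + 1) * length X"
  using assms(6,7)
proof (induction X arbitrary: p z)
  case Nil
  then show ?case by (simp add: access_blocks_def)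
next
  case (Cons x X)
  obtain j0 p0 where p: "p = (j0, p0)" by fastforce
  have j: "j < length (trees D)" using assms(2) by (simp add: version_tree_def)
  obtain i where x: "x = (v, i)" and i: "1 \<le> i" "i \<le> U_of D" using Cons.prems(2) by (cases x) auto
  let ?r = "route (i, v) (trees D ! j)"
  let ?AB = "access_blocks \<epsilon> s base tab B D"
  obtain y as where rd: "persistent_read D (j0, p0) (v, i) = (y, (j, ?r), as)"
    and ch: "\<forall>z. changes z (?AB as) \<le> 3 * card (zone_blocks \<epsilon> s base D B j0 p0) + 1 +
      2 * card (zone_blocks \<epsilon> s base D B j ?r)"
    using read_step[OF assms(1) Cons.prems(1)[unfolded p] assms(2) i assms(3,4),
      where \<epsilon> = \<epsilon> and base = base and tab = tab] by blast
  have leaf: "leaf_ptr D (j, ?r)" by (rule leaf_ptr_route[OF j])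
  have "changes z (?AB as) \<le> 5 * u + 1"
    using ch[rule_format, of z] zone[OF Cons.prems(1)[unfolded p]] zone[OF leaf] by linarith
  moreover have "changes z' (?AB (read_accesses D (j, ?r) X)) \<le> (5 * u + 1) * length X" for z'
    by (rule Cons.IH[OF leaf]) (use Cons.prems(2) in simp)
  ultimately have "changes z (?AB as @ ?AB (read_accesses D (j, ?r) X)) \<le> (5 * u + 1) + (5 * u + 1) * length X"
    unfolding changes_append by (rule add_mono)
  then show ?case by (simp add: p x rd access_blocks_append)
qed

text \<open>The pointer stands at the leaf of column \<open>i0\<close>. The last two assumptions are
  the invariant; \<open>1 \<le> k'\<close> keeps the array block of the column just read among the
  recent ones.\<close>

lemma reads_run:
  fixes \<epsilon> :: real and W :: "int \<Rightarrow> nat set"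
  assumes "valid_pds D" and "version_tree D v j"
    and "0 < B" and "0 < s"
    and W: "\<And>b. finite (W b)" "\<And>b. card (W b) \<le> w"
    and zone: "\<And>i. 1 \<le> i \<Longrightarrow> i \<le> U_of D \<Longrightarrow>
      zone_blocks \<epsilon> s base D B j (route (i, v) (trees D ! j)) \<subseteq> W (array_block \<beta> i)"
    and "1 \<le> k'" and "(k' + 1) * w \<le> k"
    and "1 \<le> i0" and "i0 \<le> U_of D" and "\<forall>(w, i)\<in>set X. w = v \<and> 1 \<le> i \<and> i \<le> U_of D"
    and "array_block \<beta> i0 \<in> most_recent k' hs" and "(\<Union>b\<in>most_recent k' hs. W b) \<subseteq> S"
  shows "\<exists>S' n. run k S (access_blocks \<epsilon> s base tab B D (read_accesses D (j, route (i0, v) (trees D ! j)) X)) S' n \<and>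
    n \<le> w * misses k' hs (map (array_block \<beta>) (map snd X))"
  using assms(10-14)
proof (induction X arbitrary: i0 hs S)
  case Nil
  then show ?case using run_Nil[of k S] by (auto simp: access_blocks_def)
next
  case (Cons x X)
  have j: "j < length (trees D)" using assms(2) by (simp add: version_tree_def)
  obtain i where x: "x = (v, i)" and i: "1 \<le> i" "i \<le> U_of D" using Cons.prems(3) by (cases x) auto
  let ?r = "\<lambda>i. route (i, v) (trees D ! j)"
  let ?AB = "access_blocks \<epsilon> s base tab B D"
  let ?b = "array_block \<beta> i"
  let ?L = "most_recent k' hs"
  obtain y as where rd: "persistent_read D (j, ?r i0) (v, i) = (y, (j, ?r i), as)"
    and sub: "set (?AB as) \<subseteq> zone_blocks \<epsilon> s base D B j (?r i0) \<union> zone_blocks \<epsilon> s base D B j (?r i) \<union>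
      (if j = j then {} else {(tab + j) div B})"
    and ne: "?AB as \<noteq> []"
    using read_step[OF assms(1) leaf_ptr_route[OF j] assms(2) i assms(3,4),
      where \<epsilon> = \<epsilon> and base = base and tab = tab] by blast
  \<comment> \<open>The set of an array block that the ephemeral memory evicts at this access stays
    until the next read; this is the \<open>+ 1\<close> in \<open>(k' + 1) * w\<close>.\<close>
  define S1 where "S1 = (\<Union>b\<in>insert ?b ?L. W b)"
  have fin: "finite S1" using W(1) by (simp add: S1_def)
  have "card S1 \<le> (\<Sum>b\<in>insert ?b ?L. card (W b))" unfolding S1_def by (rule card_UN_le) simp
  also have "\<dots> \<le> (\<Sum>b\<in>insert ?b ?L. w)" using W(2) by (intro sum_mono)
  also have "\<dots> = card (insert ?b ?L) * w" by simp
  also have "\<dots> \<le> (k' + 1) * w"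
    using card_most_recent_le[of k' hs] by (intro mult_le_mono1) (simp add: card_insert_if)
  finally have card: "card S1 \<le> k" using assms(9) by simp
  have "set (?AB as) \<subseteq> S1"
    using sub zone[OF i] zone[OF Cons.prems(1,2)] Cons.prems(4) by (auto simp: S1_def)
  then have run1: "run k S (?AB as) S1 (card (S1 - S))" by (rule run_load[OF ne _ fin card])
  have cost: "card (S1 - S) \<le> w * (if ?b \<in> ?L then 0 else 1)"
  proof (cases "?b \<in> ?L")
    case True
    then have "S1 - S = {}" using Cons.prems(5) by (auto simp: S1_def)
    then have "card (S1 - S) = 0" by (simp only: card.empty)
    then show ?thesis by simp
  next
    case False
    have "S1 - S \<subseteq> W ?b" using Cons.prems(5) by (auto simp: S1_def)
    then have "card (S1 - S) \<le> card (W ?b)" by (intro card_mono W(1))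
    then show ?thesis using False W(2)[of ?b] by simp
  qed
  have next_S: "(\<Union>b\<in>most_recent k' (hs @ [?b]). W b) \<subseteq> S1"
    using most_recent_snoc_subset[of k' hs ?b] unfolding S1_def by (intro UN_mono) auto
  have rest: "\<forall>(w, i)\<in>set X. w = v \<and> 1 \<le> i \<and> i \<le> U_of D" using Cons.prems(3) by simp
  obtain S2 n where run2: "run k S1 (?AB (read_accesses D (j, ?r i) X)) S2 n"
    and n: "n \<le> w * misses k' (hs @ [?b]) (map (array_block \<beta>) (map snd X))"
    using Cons.IH[OF i rest most_recent_snoc_self[OF assms(8)] next_S] by blast
  have "run k S (?AB (read_accesses D (j, ?r i0) (x # X))) S2 (card (S1 - S) + n)"
    using run_append[OF run1 run2] by (simp add: x rd access_blocks_append)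
  moreover have "card (S1 - S) + n \<le> w * misses k' hs (map (array_block \<beta>) (map snd (x # X)))"
    using cost n by (simp add: misses_Cons x distrib_left)
  ultimately show ?case by blast
qed

text \<open>The two powers of \<open>B\<close> multiply to \<open>B\<close>, so \<open>k'\<close> is
  \<open>M / (3 * B)\<close> divided by \<open>a * l\<close> and rounded down. The factor 2 stems
  from \<open>M div (3 * B)\<close>: a quotient of at least 1 loses at most half of its value by
  rounding.\<close>

lemma memory_ratio:
  fixes M B :: nat and a l \<gamma> :: real
  assumes "2 \<le> B" and "3 * B \<le> M" and "0 < a" and "0 < l"
  defines "k' \<equiv> nat \<lfloor>(1 / 3 * real M) / (real B powr (1 - \<gamma>) * (a * l)) / (real B powr \<gamma>)\<rfloor>"
  shows "real k' * (a * l) \<le> 2 * real (M div (3 * B))"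
proof -
  have B: "0 < real B" using assms by simp
  have "real B powr (1 - \<gamma>) * real B powr \<gamma> = real B" using B by (simp flip: powr_add)
  then have "(1 / 3 * real M) / (real B powr (1 - \<gamma>) * (a * l)) / (real B powr \<gamma>) =
      real M / (3 * real B * (a * l))"
    by (simp add: divide_divide_eq_left mult_ac)
  then have k': "k' = nat \<lfloor>real M / (3 * real B * (a * l))\<rfloor>" by (simp only: k'_def)
  have "0 \<le> real M / (3 * real B * (a * l))" using assms by simp
  then have "real k' \<le> real M / (3 * real B * (a * l))" unfolding k' by linarith
  then have 1: "real k' * (a * l) * (3 * real B) \<le> real M"
    using assms B by (simp add: le_divide_eq mult_ac)
  define k where "k = M div (3 * B)"
  have k: "1 \<le> k" using assms by (simp add: k_def Suc_le_eq div_greater_zero_iff)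
  have "0 < 3 * B" using assms(1) by simp
  from dividend_less_div_times[OF this, of M] have "M < k * (3 * B) + 3 * B" unfolding k_def by linarith
  also have "\<dots> \<le> 2 * k * (3 * B)" using k mult_le_mono1[OF k, of "3 * B"] by simp
  finally have "real M \<le> real (2 * k * (3 * B))" by (simp only: of_nat_le_iff less_imp_le)
  then have "real M \<le> 2 * real k * (3 * real B)" by simp
  with 1 have "real k' * (a * l) * (3 * real B) \<le> 2 * real k * (3 * real B)" by linarith
  then show ?thesis using B by (simp add: k_def mult_ac)
qed

lemma persistent_runtime_le:
  fixes \<epsilon> :: real and D :: "'a pds" and p :: ptr
  defines "\<gamma> \<equiv> (1 - \<epsilon>) / log 2 3"
  assumes eps: "0 < \<epsilon>" "\<epsilon> < 1" and s: "1 \<le> s" and D: "valid_pds D" and B: "2 \<le> B" and M: "3 * B \<le> M"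
    and p: "leaf_ptr D p" and v: "1 \<le> v" "v \<le> V_of D"
    and X: "\<forall>(w, i)\<in>set X. w = v \<and> 1 \<le> i \<and> i \<le> U_of D"
  defines "K \<equiv> part_const \<epsilon> s" and "l \<equiv> 1 + log (real B) (real (U_of D))"
  shows "\<exists>n. persistent_runtime \<epsilon> s base tab M B D p X \<le> enat n \<and>
    real n \<le> 8 * K * (real (ephemeral_cost ((1 / 3 * real M) / (real B powr (1 - \<gamma>) * (28 * K * l)))
      (real B powr \<gamma>) (map snd X)) * l)"
proof -
  define k where "k = M div (3 * B)"
  define k' where "k' = nat \<lfloor>(1 / 3 * real M) / (real B powr (1 - \<gamma>) * (28 * K * l)) / (real B powr \<gamma>)\<rfloor>"
  define \<beta> where "\<beta> = real B powr \<gamma>"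
  define T where "T = misses k' [] (map (array_block \<beta>) (map snd X))"
  let ?AB = "access_blocks \<epsilon> s base tab B D"
  have K: "1 \<le> K" using part_const_ge[OF eps] by (simp add: K_def)
  have l: "1 \<le> l" using B by (simp add: l_def U_of_def log_nat_power)
  have Kl: "1 \<le> K * l" using K l mult_mono[of 1 K 1 l] by simp
  have B0: "0 < B" and s0: "0 < s" using B s by simp_all
  have k: "1 \<le> k" using B M by (simp add: k_def Suc_le_eq div_greater_zero_iff)
  have kk': "real k' * (28 * (K * l)) \<le> 2 * real k"
    using memory_ratio[OF B M, of "28 * K" l \<gamma>] K l by (simp add: k_def k'_def mult_ac)
  have cost: "ephemeral_cost ((1 / 3 * real M) / (real B powr (1 - \<gamma>) * (28 * K * l))) (real B powr \<gamma>) (map snd X) = T"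
    by (simp only: ephemeral_cost_misses T_def k'_def \<beta>_def)
  have runtime: "persistent_runtime \<epsilon> s base tab M B D p X = optimal_cost k (?AB (read_accesses D p X))"
    by (simp add: persistent_runtime_def access_blocks_def k_def)
  have "\<exists>n S. run k {} (?AB (read_accesses D p X)) S n \<and> real n \<le> 8 * (K * l) * real T"
  proof (cases X)
    case Nil
    then show ?thesis using run_Nil[of k "{}"] by (auto simp: access_blocks_def T_def misses_Nil)
  next
    case (Cons x X')
    obtain j0 p0 where p_eq: "p = (j0, p0)" by fastforce
    obtain i where x: "x = (v, i)" and i: "1 \<le> i" "i \<le> U_of D" using X Cons by (cases x) auto
    obtain j where j: "version_tree D v j" using ex_version_tree[OF D v] by blast
    let ?r = "\<lambda>i. route (i, v) (trees D ! j)"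
    obtain m where m: "1 \<le> m" "ternary_size m \<le> B" "B < ternary_size (Suc m)"
      using ternary_levels[of B] B by auto
    have zone: "real (card (zone_blocks \<epsilon> s base D B j p)) \<le> K * l" if "leaf_ptr D (j, p)" for j p
    proof -
      have "j < length (trees D)" using that by (simp add: leaf_ptr_def)
      from part_blocks[OF eps D this B m leaf_ptr_length[OF D that], of s base] leaf_ptr_length[OF D that]
      obtain Z where Z: "finite Z" "real (card Z) \<le> K * l" "zone_blocks \<epsilon> s base D B j p \<subseteq> Z"
        unfolding K_def l_def by blast
      from card_mono[OF Z(1,3)] Z(2) show ?thesis by linarith
    qed
    show ?thesis
    proof (cases "k' = 0")
      case True
      define u where "u = nat \<lfloor>K * l\<rfloor>"
      have u: "real u \<le> K * l" using Kl unfolding u_def by linarith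
      have zone_u: "card (zone_blocks \<epsilon> s base D B j p) \<le> u" if "leaf_ptr D (j, p)" for j p
        using zone[OF that] unfolding u_def by linarith
      obtain S n where n: "run k {} (?AB (read_accesses D p X)) S n"
        "n \<le> Suc (changes 0 (?AB (read_accesses D p X)))"
        using run_changes_empty[OF k] by blast
      have "changes 0 (?AB (read_accesses D p X)) \<le> (5 * u + 1) * length X"
        by (rule reads_changes[OF D j B0 s0 _ p X]) (rule zone_u)
      \<comment> \<open>The extra transfer for the initially empty memory is charged to a read,
        which exists because \<open>X\<close> is not empty.\<close>
      then have "n \<le> (5 * u + 2) * length X" using n(2) Cons by simp
      then have "real n \<le> real ((5 * u + 2) * length X)" by (simp only: of_nat_le_iff)
      also have "\<dots> = (5 * real u + 2) * real (length X)" by (simp add: distrib_right)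
      also have "\<dots> \<le> (8 * (K * l)) * real (length X)"
        using u Kl by (intro mult_right_mono) auto
      also have "length X = T" using True by (simp add: T_def misses_zero)
      finally show ?thesis using n(1) by blast
    next
      case False
      then have k'1: "1 \<le> k'" by simp
      have "\<forall>b. \<exists>Z. finite Z \<and> real (card Z) \<le> 5 * (K * l) \<and>
        (\<forall>i. 1 \<le> i \<longrightarrow> i \<le> U_of D \<longrightarrow> array_block \<beta> i = b \<longrightarrow> zone_blocks \<epsilon> s base D B j (?r i) \<subseteq> Z)"
        unfolding K_def l_def \<beta>_def \<gamma>_def
        by (intro allI column_blocks[OF eps D j B])
      then obtain W where W: "\<And>b. finite (W b)" "\<And>b. real (card (W b)) \<le> 5 * (K * l)"
        and Wz: "\<And>i. 1 \<le> i \<Longrightarrow> i \<le> U_of D \<Longrightarrow> zone_blocks \<epsilon> s base D B j (?r i) \<subseteq> W (array_block \<beta> i)"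
        by metis
      define w where "w = nat \<lfloor>7 * (K * l)\<rfloor>"
      have w: "real w \<le> 7 * (K * l)" using Kl unfolding w_def by linarith
      have Ww: "card (W b) \<le> w" for b using W(2)[of b] Kl unfolding w_def by linarith
      have "real ((k' + 1) * w) \<le> (2 * real k') * (7 * (K * l))"
        unfolding of_nat_mult using w k'1 by (intro mult_mono) auto
      also have "\<dots> \<le> real k" using kk' by (simp add: mult_ac)
      finally have room: "(k' + 1) * w \<le> k" by (simp only: of_nat_le_iff)
      define b where "b = array_block \<beta> i"
      \<comment> \<open>All that the first read can touch, starting from any leaf of any tree, and
        in addition the set \<open>W b\<close> required by the invariant for the reads after
        it.\<close>
      define S0 where "S0 = zone_blocks \<epsilon> s base D B j0 p0 \<union> {(tab + j) div B} \<union> W b"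
      have finS0: "finite S0" using W(1) by (simp add: S0_def finite_zone_blocks)
      have "card S0 \<le> card (zone_blocks \<epsilon> s base D B j0 p0) + 1 + card (W b)"
        unfolding S0_def by (rule order_trans[OF card_Un_le add_right_mono[OF order_trans[OF card_Un_le]]]) simp
      then have "real (card S0) \<le> 7 * (K * l)"
        using zone[OF p[unfolded p_eq]] W(2)[of b] Kl by linarith
      then have S0w: "card S0 \<le> w" unfolding w_def by linarith
      also have "w \<le> (k' + 1) * w" by simp
      finally have S0k: "card S0 \<le> k" using room by simp
      obtain y as where rd: "persistent_read D (j0, p0) (v, i) = (y, (j, ?r i), as)"
        and sub: "set (?AB as) \<subseteq> zone_blocks \<epsilon> s base D B j0 p0 \<union> zone_blocks \<epsilon> s base D B j (?r i) \<union>
          (if j0 = j then {} else {(tab + j) div B})"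
        and ne: "?AB as \<noteq> []"
        using read_step[OF D p[unfolded p_eq] j i B0 s0, where tab = tab and \<epsilon> = \<epsilon> and base = base] by blast
      have "set (?AB as) \<subseteq> S0" using sub Wz[OF i] by (auto simp: S0_def b_def split: if_splits)
      then have run0: "run k {} (?AB as) S0 (card (S0 - {}))" by (rule run_load[OF ne _ finS0 S0k])
      have hist: "b \<in> most_recent k' [b]" "most_recent k' [b] \<subseteq> {b}"
        using most_recent_snoc_self[OF k'1, of b "[]"] most_recent_snoc_subset[of k' "[]" b]
        by (simp_all add: most_recent_Nil)
      obtain S n where run1: "run k S0 (?AB (read_accesses D (j, ?r i) X')) S n"
        and n: "n \<le> w * misses k' [b] (map (array_block \<beta>) (map snd X'))"
      proof -
        have "\<exists>S n. run k S0 (?AB (read_accesses D (j, ?r i) X')) S n \<and>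
          n \<le> w * misses k' [b] (map (array_block \<beta>) (map snd X'))"
          by (rule reads_run[where W = W and \<beta> = \<beta>, OF D j B0 s0 W(1) Ww _ k'1 room i])
            (use Wz X Cons hist in \<open>auto simp: S0_def b_def\<close>)
        then show thesis using that by blast
      qed
      have "run k {} (?AB (read_accesses D p X)) S (card S0 + n)"
        using run_append[OF run0 run1] by (simp add: Cons x p_eq rd access_blocks_append)
      moreover have "real (card S0 + n) \<le> 8 * (K * l) * real T"
      proof -
        \<comment> \<open>With an empty history the first ephemeral access is a miss, and this miss
          pays for loading \<open>S0\<close>.\<close>
        have "T = 1 + misses k' [b] (map (array_block \<beta>) (map snd X'))"
          by (simp add: T_def Cons x misses_Cons most_recent_Nil b_def)
        then have "card S0 + n \<le> w * T" using S0w n by simp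
        then have "real (card S0 + n) \<le> real w * real T" by (metis of_nat_le_iff of_nat_mult)
        also have "\<dots> \<le> 8 * (K * l) * real T" using w Kl by (intro mult_right_mono) auto
        finally show ?thesis .
      qed
      ultimately show ?thesis by blast
    qed
  qed
  then obtain n S where "run k {} (?AB (read_accesses D p X)) S n" "real n \<le> 8 * (K * l) * real T" by blast
  then show ?thesis
    unfolding cost runtime using optimal_cost_le by (intro exI[of _ n]) (auto simp: mult_ac)
qed

text \<open>The constant \<open>a\<close> belongs to the asymptotic notation: the paths below an
  array block occupy a constant multiple of \<open>l\<close> memory blocks, which scales the
  ephemeral memory that can be simulated. Both constants depend on \<open>\<epsilon>\<close> and
  \<open>s\<close> only.\<close>

theorem theorem2:
  fixes \<epsilon> :: real and s :: nat
  assumes "0 < \<epsilon>" and "\<epsilon> < 1" and "1 \<le> s"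
  shows "\<exists>a>0. \<exists>c>0.
    \<forall>(ws :: (nat \<times> 'a) list) base tab M B p v X.
      (\<forall>(i, x)\<in>set ws. 1 \<le> i) \<longrightarrow>
      2 \<le> B \<longrightarrow> 3 * B \<le> M \<longrightarrow>
      leaf_ptr (after_writes ws) p \<longrightarrow>
      1 \<le> v \<longrightarrow> v \<le> V_of (after_writes ws) \<longrightarrow>
      (\<forall>(w, i)\<in>set X. w = v \<and> 1 \<le> i \<and> i \<le> U_of (after_writes ws)) \<longrightarrow>
      (let D = after_writes ws;
           \<gamma> = (1 - \<epsilon>) / log 2 3;
           l = 1 + log (real B) (real (U_of D));
           T = (\<lambda>M' B'. real (ephemeral_cost M' B' (map snd X)))
       in ereal_of_enat (persistent_runtime \<epsilon> s base tab M B D p X)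
          \<le> ereal (c * (T ((1 / 3 * real M) / (real B powr (1 - \<gamma>) * (a * l))) (real B powr \<gamma>) * l)))"
proof -
  let ?K = "part_const \<epsilon> s"
  have K: "0 < ?K" using part_const_ge[OF assms(1,2), of s] by linarith
  have "ereal_of_enat (persistent_runtime \<epsilon> s base tab M B (after_writes ws) p X) \<le>
      ereal (8 * ?K * (real (ephemeral_cost
        ((1 / 3 * real M) / (real B powr (1 - (1 - \<epsilon>) / log 2 3) *
          (28 * ?K * (1 + log (real B) (real (U_of (after_writes ws)))))))
        (real B powr ((1 - \<epsilon>) / log 2 3)) (map snd X)) *
        (1 + log (real B) (real (U_of (after_writes ws))))))"
    if asm: "\<forall>(i, x)\<in>set ws. 1 \<le> i" "2 \<le> B" "3 * B \<le> M" "leaf_ptr (after_writes ws) p" "1 \<le> v"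
      "v \<le> V_of (after_writes ws)" "\<forall>(w, i)\<in>set X. w = v \<and> 1 \<le> i \<and> i \<le> U_of (after_writes ws)"
    for ws :: "(nat \<times> 'a) list" and base tab M B p v X
  proof -
    obtain n where n: "persistent_runtime \<epsilon> s base tab M B (after_writes ws) p X \<le> enat n"
      and le: "real n \<le> 8 * ?K * (real (ephemeral_cost
        ((1 / 3 * real M) / (real B powr (1 - (1 - \<epsilon>) / log 2 3) *
          (28 * ?K * (1 + log (real B) (real (U_of (after_writes ws)))))))
        (real B powr ((1 - \<epsilon>) / log 2 3)) (map snd X)) *
        (1 + log (real B) (real (U_of (after_writes ws)))))"
      using persistent_runtime_le[OF assms valid_pds_after_writes[OF asm(1)] asm(2-7), of base tab] by blast
    have "ereal_of_enat (persistent_runtime \<epsilon> s base tab M B (after_writes ws) p X) \<le> ereal_of_enat (enat n)"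
      using n by (simp only: ereal_of_enat_le_iff)
    also have "\<dots> = ereal (real n)" by simp
    also note le[folded ereal_less_eq(3)]
    finally show ?thesis .
  qed
  then show ?thesis
    unfolding Let_def using K by (intro exI[of _ "28 * ?K"] exI[of _ "8 * ?K"] conjI allI impI) auto
qed

end
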